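(* Let $\Sigma=(V,E,\sigma)$ be a signed graph and $\mathbb A$ an abelian group. Then $${\rm B}_0(\Sigma,\mathbb A)\cong(2\mathbb A)^{u_c(\Sigma)}\oplus\mathbb A^{r(\Sigma)-u_c(\Sigma)}.$$ More specifically, when $\Sigma$ is connected, the following hold. (a) If $\Sigma$ is balanced, with a switching $\nu$ such that all edges of $\Sigma^\nu$ are positive, then $${\rm B}_0(\Sigma,\mathbb A)=\Big\{{\bf b}\in{\rm C}_0(\Sigma,\mathbb A):\sum_{v\in V}\nu(v){\bf b}(v)=0\Big\}\cong\mathbb A^{|V|-1}.$$ (b) If $\Sigma$ is unbalanced and contains no outer-edges, and $\nu$ is a switching such that all edges of some spanning tree of $\Sigma$ are positive in $\Sigma^\nu$, then $${\rm B}_0(\Sigma,\mathbb A)=\Big\{{\bf b}\in{\rm C}_0(\Sigma,\mathbb A):\sum_{v\in V}\nu(v){\bf b}(v)\in2\mathbb A\Big\}\cong2\mathbb A\oplus\mathbb A^{|V|-1}.$$ (c) If $\Sigma$ contains outer-edges, then ${\rm B}_0(\Sigma,\mathbb A)={\rm C}_0(\Sigma,\mathbb A)\cong\mathbb A^{|V|}$.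
   Context: A graph $(V,E)$ has finite vertex set $V$ and finite edge set $E$ (multiple edges allowed); each edge has two ends, each end is attached to one vertex or to none, and at least one end is attached to a vertex. A loop has both ends at the same vertex, a link has its ends at two distinct vertices, an outer-edge has exactly one end attached to a vertex. A signed graph $\Sigma=(V,E,\sigma)$ is a graph with a sign function $\sigma:E\to\{1,-1\}$. A circle is a connected 2-regular signed (sub)graph without outer-edges (a loop with its vertex is a circle); its sign is the product of its edge signs. A signed graph is balanced if it has no outer-edges and all its circles are positive; otherwise unbalanced. $b(\Sigma)$ is the number of balanced components, $u_c(\Sigma)$ the number of unbalanced components without outer-edges, and $r(\Sigma)=|V|-b(\Sigma)$. $2\mathbb A=\{2a:a\in\mathbb A\}$. A switching is a function $\nu:V\to\{1,-1\}$; $\Sigma^\nu$ has the same vertices and edges and sign $\sigma^\nu(e)=\nu(u)\sigma(e)\nu(v)$ for a loop or link $e=uv$, $\sigma^\nu(e)=\nu(u)\sigma(e)$ for an outer-edge at $u$. Each edge $e$ has exactly two orientations (arcs) $\vec e$ and $\vec e^{\,-1}$: an orientation puts an arrow on each of the two ends of $e$, with the same direction along $e$ if $e$ is positive and opposite directions if $e$ is negative; $\vec e^{\,-1}$ reverses both arrows. $\vec E$ is the set of all arcs. $[v,\vec e\,]$ is $1$ (resp. $-1$) if $\vec e$ is a non-loop arc at $v$ whose arrow at $v$ points to (resp. away from) $v$; $2$ (resp. $-2$) if $\vec e$ is a negative loop at $v$ pointing to (resp. away from) $v$; $0$ otherwise. ${\rm C}_1(\Sigma,\mathbb A)$ is the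 group of functions ${\bf c}:\vec E\to\mathbb A$ with ${\bf c}(\vec e^{\,-1})=-{\bf c}(\vec e\,)$; ${\rm C}_0(\Sigma,\mathbb A)$ is the group of functions $V\to\mathbb A$. The boundary operator $\partial:{\rm C}_1(\Sigma,\mathbb A)\to{\rm C}_0(\Sigma,\mathbb A)$ is $(\partial{\bf c})(v)=\sum_{e\in E}[v,\vec e\,]{\bf c}(\vec e\,)$, and ${\rm B}_0(\Sigma,\mathbb A)={\rm im}\,\partial$. *)

theory Defs
  imports "HOL-Algebra.Product_Groups" "HOL-Algebra.FiniteProduct"
begin

section \<open>Signed graphs\<close>

text \<open>
  The two ends of an edge are indexed by \<^typ>\<open>bool\<close>; \<open>att G e i\<close> is the vertex to which the end \<open>i\<close>
  of \<open>e\<close> is attached, or \<^term>\<open>None\<close> if that end is attached to no vertex. Edges are abstract,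
  so multiple edges are allowed. The values of \<open>att\<close> and \<open>esign\<close> outside \<open>edges G\<close> are irrelevant.
\<close>

record ('v, 'e) sgraph =
  verts :: "'v set"
  edges :: "'e set"
  att :: "'e \<Rightarrow> bool \<Rightarrow> 'v option"
  esign :: "'e \<Rightarrow> int"

definition signed_graph :: "('v, 'e) sgraph \<Rightarrow> bool" where
  "signed_graph G \<longleftrightarrow>
     finite (verts G) \<and> finite (edges G) \<and>
     (\<forall>e\<in>edges G. (\<exists>i. att G e i \<noteq> None) \<and>
                   (\<forall>i v. att G e i = Some v \<longrightarrow> v \<in> verts G) \<and>
                   esign G e \<in> {1, -1})"

definition is_loop :: "('v, 'e) sgraph \<Rightarrow> 'e \<Rightarrow> bool" where
  "is_loop G e \<longleftrightarrow> (\<exists>v. att G e True = Some v \<and> att G e False = Some v)"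

definition is_outer :: "('v, 'e) sgraph \<Rightarrow> 'e \<Rightarrow> bool" where
  "is_outer G e \<longleftrightarrow> (\<exists>!i. att G e i \<noteq> None)"

definition has_outer_edge :: "('v, 'e) sgraph \<Rightarrow> bool" where
  "has_outer_edge G \<longleftrightarrow> (\<exists>e\<in>edges G. is_outer G e)"

definition subgraph :: "('v, 'e) sgraph \<Rightarrow> ('v, 'e) sgraph \<Rightarrow> bool" where
  "subgraph H G \<longleftrightarrow> signed_graph H \<and> verts H \<subseteq> verts G \<and> edges H \<subseteq> edges G \<and>
                     att H = att G \<and> esign H = esign G"

definition adj :: "('v, 'e) sgraph \<Rightarrow> ('v \<times> 'v) set" where
  "adj G = {(u, v). \<exists>e\<in>edges G. \<exists>i. att G e i = Some u \<and> att G e (\<not> i) = Some v}"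

definition graph_connected :: "('v, 'e) sgraph \<Rightarrow> bool" where
  "graph_connected G \<longleftrightarrow> verts G \<noteq> {} \<and> (\<forall>u\<in>verts G. \<forall>v\<in>verts G. (u, v) \<in> (adj G)\<^sup>*)"

definition components :: "('v, 'e) sgraph \<Rightarrow> ('v, 'e) sgraph set" where
  "components G = {H. subgraph H G \<and> graph_connected H \<and>
     (\<forall>H'. subgraph H' G \<and> graph_connected H' \<and> subgraph H H' \<longrightarrow> H' = H)}"

text \<open>A loop at \<open>v\<close> has two ends at \<open>v\<close> and therefore contributes 2 to the degree.\<close>

definition degree :: "('v, 'e) sgraph \<Rightarrow> 'v \<Rightarrow> nat" where
  "degree G v = card {(e, i). e \<in> edges G \<and> att G e i = Some v}"

definition circle :: "('v, 'e) sgraph \<Rightarrow> bool" where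
  "circle C \<longleftrightarrow> signed_graph C \<and> graph_connected C \<and> (\<forall>v\<in>verts C. degree C v = 2) \<and>
                \<not> has_outer_edge C"

definition circle_sign :: "('v, 'e) sgraph \<Rightarrow> int" where
  "circle_sign C = (\<Prod>e\<in>edges C. esign C e)"

definition balanced :: "('v, 'e) sgraph \<Rightarrow> bool" where
  "balanced G \<longleftrightarrow> \<not> has_outer_edge G \<and>
                  (\<forall>C. subgraph C G \<and> circle C \<longrightarrow> circle_sign C = 1)"

definition num_balanced :: "('v, 'e) sgraph \<Rightarrow> nat" where
  "num_balanced G = card {H \<in> components G. balanced H}"

definition num_unbalanced_closed :: "('v, 'e) sgraph \<Rightarrow> nat" where
  "num_unbalanced_closed G =
     card {H \<in> components G. \<not> balanced H \<and> \<not> has_outer_edge H}"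

definition rank :: "('v, 'e) sgraph \<Rightarrow> nat" where
  "rank G = card (verts G) - num_balanced G"

definition spanning_tree :: "('v, 'e) sgraph \<Rightarrow> ('v, 'e) sgraph \<Rightarrow> bool" where
  "spanning_tree T G \<longleftrightarrow> subgraph T G \<and> verts T = verts G \<and> graph_connected T \<and>
                        \<not> has_outer_edge T \<and> \<not> (\<exists>C. subgraph C T \<and> circle C)"

definition switching :: "('v, 'e) sgraph \<Rightarrow> ('v \<Rightarrow> int) \<Rightarrow> bool" where
  "switching G \<nu> \<longleftrightarrow> (\<forall>v\<in>verts G. \<nu> v \<in> {1, -1})"

text \<open>An end attached to no vertex contributes the factor 1.\<close>

definition switch :: "('v, 'e) sgraph \<Rightarrow> ('v \<Rightarrow> int) \<Rightarrow> ('v, 'e) sgraph" where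
  "switch G \<nu> = (let f = (\<lambda>x. case x of None \<Rightarrow> 1 | Some v \<Rightarrow> \<nu> v) in
     G\<lparr>esign := (\<lambda>e. f (att G e True) * esign G e * f (att G e False))\<rparr>)"


section \<open>Arcs\<close>

text \<open>
  An arc is an edge \<open>e\<close> with a map \<open>d\<close> giving the arrow on each end \<open>i\<close> of \<open>e\<close>: \<open>d i = 1\<close> if the arrow
  points outwards, that is, to the vertex (if any) at the end \<open>i\<close>, and \<open>d i = -1\<close> if it points away
  from it. Arrows on the two ends have the same direction along \<open>e\<close> iff \<open>d True = - d False\<close>, so the
  condition that this happens exactly for positive edges reads \<open>d True * d False = - esign G e\<close>.
\<close>

type_synonym 'e arc = "'e \<times> (bool \<Rightarrow> int)"

definition arcs :: "('v, 'e) sgraph \<Rightarrow> 'e arc set" where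
  "arcs G = {(e, d). e \<in> edges G \<and> (\<forall>i. d i \<in> {1, -1}) \<and> d True * d False = - esign G e}"

definition arc_inv :: "'e arc \<Rightarrow> 'e arc" where
  "arc_inv a = (fst a, \<lambda>i. - snd a i)"

fun incidence :: "('v, 'e) sgraph \<Rightarrow> 'v \<Rightarrow> 'e arc \<Rightarrow> int" where
  "incidence G v (e, d) =
     (if is_loop G e then
        (if att G e True = Some v \<and> esign G e = -1 then 2 * d True else 0)
      else if att G e True = Some v then d True
      else if att G e False = Some v then d False
      else 0)"

lemma incidence_arc_inv: "incidence G v (arc_inv a) = - incidence G v a"
  by (cases a) (simp add: arc_inv_def)

lemma arcs_of_edge:
  assumes "signed_graph G" "e \<in> edges G"
  shows "\<exists>a. {b \<in> arcs G. fst b = e} = {a, arc_inv a} \<and> a \<noteq> arc_inv a"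
proof -
  have s: "esign G e \<in> {1, -1}"
    using assms by (auto simp: signed_graph_def)
  define d where "d = (\<lambda>i. if i then 1 else - esign G e)"
  have m: "(e, d) \<in> arcs G" "arc_inv (e, d) \<in> arcs G"
    using assms s by (auto simp: arcs_def arc_inv_def d_def)
  have "b = (e, d) \<or> b = arc_inv (e, d)" if b: "b \<in> arcs G" "fst b = e" for b
  proof -
    obtain d' where b': "b = (e, d')" using b(2) by (cases b) auto
    have h: "d' True \<in> {1, -1}" "d' True * d' False = - esign G e"
      using b(1) by (auto simp: b' arcs_def)
    consider "d' True = 1" | "d' True = -1" using h by auto
    then show ?thesis
    proof cases
      case 1
      then have "d' i = d i" for i using h by (cases i) (auto simp: d_def)
      then show ?thesis by (auto simp: b')
    next
      case 2
      then have "d' i = - d i" for i using h by (cases i) (auto simp: d_def)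
      then show ?thesis by (auto simp: b' arc_inv_def)
    qed
  qed
  moreover have "(e, d) \<noteq> arc_inv (e, d)"
    by (auto simp: arc_inv_def d_def dest: fun_cong[where x = True])
  ultimately have "{b \<in> arcs G. fst b = e} = {(e, d), arc_inv (e, d)} \<and> (e, d) \<noteq> arc_inv (e, d)"
    using m by (auto simp: arc_inv_def)
  then show ?thesis by blast
qed


section \<open>Chains and the boundary operator\<close>

text \<open>
  The abelian coefficient group \<open>A\<close> is written multiplicatively, as usual in HOL-Algebra: sums are
  finite products, and the integer multiple \<open>n a\<close> is the power \<open>a [^]\<^bsub>A\<^esub> n\<close>.
\<close>

definition twice :: "'a monoid \<Rightarrow> 'a monoid" where
  "twice A = A\<lparr>carrier := {a [^]\<^bsub>A\<^esub> (2::int) | a. a \<in> carrier A}\<rparr>"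

definition gpow :: "'a monoid \<Rightarrow> nat \<Rightarrow> (nat \<Rightarrow> 'a) monoid" where
  "gpow A n = product_group {..<n} (\<lambda>_. A)"

definition C0 :: "('v, 'e) sgraph \<Rightarrow> 'a monoid \<Rightarrow> ('v \<Rightarrow> 'a) monoid" where
  "C0 G A = product_group (verts G) (\<lambda>_. A)"

definition C1 :: "('v, 'e) sgraph \<Rightarrow> 'a monoid \<Rightarrow> ('e arc \<Rightarrow> 'a) monoid" where
  "C1 G A = (product_group (arcs G) (\<lambda>_. A))
     \<lparr>carrier := {c \<in> arcs G \<rightarrow>\<^sub>E carrier A. \<forall>a\<in>arcs G. c (arc_inv a) = inv\<^bsub>A\<^esub> (c a)}\<rparr>"

text \<open>
  The boundary is a sum over edges, evaluated at an arbitrary orientation of each edge. By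
  \<open>arcs_of_edge\<close> and \<open>incidence_arc_inv\<close> the summand does not depend on the orientation chosen:
  inverting the arc changes the sign of both factors.
\<close>

definition some_arc :: "('v, 'e) sgraph \<Rightarrow> 'e \<Rightarrow> 'e arc" where
  "some_arc G e = (SOME a. a \<in> arcs G \<and> fst a = e)"

definition boundary :: "('v, 'e) sgraph \<Rightarrow> 'a monoid \<Rightarrow> ('e arc \<Rightarrow> 'a) \<Rightarrow> ('v \<Rightarrow> 'a)" where
  "boundary G A c = (\<lambda>v\<in>verts G.
     \<Otimes>\<^bsub>A\<^esub>e\<in>edges G. c (some_arc G e) [^]\<^bsub>A\<^esub> incidence G v (some_arc G e))"

definition B0 :: "('v, 'e) sgraph \<Rightarrow> 'a monoid \<Rightarrow> ('v \<Rightarrow> 'a) monoid" where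
  "B0 G A = (C0 G A)\<lparr>carrier := boundary G A ` carrier (C1 G A)\<rparr>"

definition weighted_sum :: "('v, 'e) sgraph \<Rightarrow> 'a monoid \<Rightarrow> ('v \<Rightarrow> int) \<Rightarrow> ('v \<Rightarrow> 'a) \<Rightarrow> 'a" where
  "weighted_sum G A \<nu> b = (\<Otimes>\<^bsub>A\<^esub>v\<in>verts G. b v [^]\<^bsub>A\<^esub> \<nu> v)"

end

theory Submission
  imports Defs
begin

text \<open>
  Write \<open>a \<delta>\<^sub>v\<close> for the 0-chain with value \<open>a\<close> at \<open>v\<close> and 0 elsewhere. The group of boundaries is
  generated by the chains \<open>a \<delta>\<^sub>u - \<sigma>(e) a \<delta>\<^sub>v\<close>, one for each link or loop \<open>e = uv\<close> (for a positive loop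
  this is 0 and for a negative one \<open>2a \<delta>\<^sub>u\<close>), and \<open>a \<delta>\<^sub>u\<close>, one for each outer-edge at \<open>u\<close>. So
  modulo boundaries a value may be transported along a walk at the cost of the sign of the walk
  (\<open>B_walk\<close>). Choose a root \<open>r\<close> in each component and a switching \<open>\<nu>\<close> that makes some walk from each
  vertex to its root positive. Transport along these walks shows that a 0-chain \<open>b\<close> agrees modulo
  boundaries with the chain having, up to the sign \<open>\<nu>(r)\<close>, the value \<open>S\<^sub>r(b) = \<Sum>\<nu>(v)b(v)\<close>, summed
  over the component of \<open>r\<close>, at every root \<open>r\<close>, and 0 elsewhere.

  Which values \<open>a\<close> at a root \<open>r\<close> are boundaries depends on the component of \<open>r\<close>:

  \<^item> all of them, if the component has an outer-edge, since they can be transported to it;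
  \<^item> those in \<open>2A\<close>, if it is unbalanced without outer-edges: transport around a negative closed walk
    gives \<open>c \<delta>\<^sub>r + c \<delta>\<^sub>r\<close>, while every edge contributes an even multiple to \<open>S\<^sub>r\<close>;
  \<^item> only 0, if it is balanced: then \<open>\<nu>\<close> makes all its edges positive, and \<open>S\<^sub>r\<close> vanishes on the
    generators.

  Hence \<open>b\<close> is a boundary iff \<open>S\<^sub>r(b)\<close> lies in the subgroup \<open>root_values r\<close> for every root \<open>r\<close>
  (\<open>B_iff\<close>). The descriptions of the image for a connected graph are this statement for its single
  root. Taking \<open>S\<^sub>r(b)\<close> as a coordinate in place of \<open>b(r)\<close> exhibits the image as a product with one
  factor \<open>A\<close>, \<open>2A\<close> or 0 for each vertex (\<open>B_iso_B_coords\<close>), and counting the factors gives the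
  isomorphism type.

  The combinatorial input is that negative closed walks and negative circles detect the same thing:
  a shortest negative closed walk is a circle (\<open>negative_closed_walk_circle\<close>), and a
  switching that makes all edges positive makes all circles positive (\<open>circle_sign_positive\<close>).
\<close>

section \<open>Signed walks\<close>

text \<open>
  A walk is a list of darts: the dart \<open>(e, i)\<close> traverses \<open>e\<close> from its end \<open>i\<close> to its other end.
\<close>

fun walk :: "('v, 'e) sgraph \<Rightarrow> 'v \<Rightarrow> ('e \<times> bool) list \<Rightarrow> 'v \<Rightarrow> bool" where
  "walk G u [] v \<longleftrightarrow> u = v"
| "walk G u ((e, i) # p) v \<longleftrightarrow>
     e \<in> edges G \<and> att G e i = Some u \<and> (\<exists>w. att G e (\<not> i) = Some w \<and> walk G w p v)"

definition walk_sign :: "('v, 'e) sgraph \<Rightarrow> ('e \<times> bool) list \<Rightarrow> int" where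
  "walk_sign G p = prod_list (map (esign G \<circ> fst) p)"

definition tail :: "('v, 'e) sgraph \<Rightarrow> 'e \<times> bool \<Rightarrow> 'v" where
  "tail G d = the (att G (fst d) (snd d))"

definition head :: "('v, 'e) sgraph \<Rightarrow> 'e \<times> bool \<Rightarrow> 'v" where
  "head G d = the (att G (fst d) (\<not> snd d))"

lemma walk_sign_simps [simp]:
  "walk_sign G [] = 1"
  "walk_sign G (d # p) = esign G (fst d) * walk_sign G p"
  "walk_sign G (p @ q) = walk_sign G p * walk_sign G q"
  by (simp_all add: walk_sign_def)

lemma both_ends_attached:
  assumes "signed_graph G" "e \<in> edges G" "\<not> is_outer G e"
  shows "\<exists>v. att G e i = Some v"
proof (rule ccontr)
  assume n: "\<nexists>v. att G e i = Some v"
  obtain j where j: "att G e j \<noteq> None" using assms(1,2) unfolding signed_graph_def by blast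
  have "k = j" if "att G e k \<noteq> None" for k
  proof -
    have "k \<noteq> i"
    proof
      assume "k = i"
      with n that show False by simp
    qed
    moreover have "j \<noteq> i"
    proof
      assume "j = i"
      with n j show False by simp
    qed
    ultimately show ?thesis by blast
  qed
  with j assms(3) show False unfolding is_outer_def by blast
qed

lemma walk_append: "walk G u (p @ q) v \<longleftrightarrow> (\<exists>w. walk G u p w \<and> walk G w q v)"
proof (induction p arbitrary: u)
  case (Cons d p)
  obtain e i where d: "d = (e, i)" by (cases d)
  have "walk G u ((e, i) # (p @ q)) v \<longleftrightarrow> (\<exists>w. walk G u ((e, i) # p) w \<and> walk G w q v)"
    unfolding walk.simps Cons.IH by metis
  then show ?case by (simp add: d)
qed simp

lemma walk_Cons_tail: "walk G u (d # p) v \<Longrightarrow> tail G d = u"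
  by (cases d) (auto simp: tail_def)

lemma walk_dart:
  assumes "walk G u p v" "d \<in> set p"
  shows "fst d \<in> edges G" "att G (fst d) (snd d) = Some (tail G d)"
    "att G (fst d) (\<not> snd d) = Some (head G d)"
  using assms by (induction p arbitrary: u) (auto simp: tail_def head_def)

lemma walk_heads: "walk G u p v \<Longrightarrow> u # map (head G) p = map (tail G) p @ [v]"
proof (induction p arbitrary: u)
  case (Cons d p)
  obtain e i where d: "d = (e, i)" by (cases d)
  obtain w where "att G e (\<not> i) = Some w" "walk G w p v" "att G e i = Some u"
    using Cons.prems by (auto simp: d)
  with Cons.IH[of w] show ?case
    by (auto simp: d head_def tail_def)
qed simp

lemma walk_sign_range:
  assumes "signed_graph G" "walk G u p v"
  shows "walk_sign G p \<in> {1, -1}"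
  using assms(2)
proof (induction p arbitrary: u)
  case (Cons d p)
  obtain e i where d: "d = (e, i)" by (cases d)
  obtain w where "walk G w p v" "e \<in> edges G"
    using Cons.prems by (auto simp: d)
  moreover from this have "esign G e \<in> {1, -1}"
    using assms(1) by (auto simp: signed_graph_def)
  ultimately show ?case
    using Cons.IH[of w] by (auto simp: d)
qed simp

lemma walk_verts:
  assumes "signed_graph G" "walk G u p v" "u \<in> verts G"
  shows "v \<in> verts G"
  using assms(2,3)
proof (induction p arbitrary: u)
  case (Cons d p)
  obtain e i where d: "d = (e, i)" by (cases d)
  show ?case
    using Cons assms(1) by (auto simp: d signed_graph_def)
qed simp

lemma walk_reverse:
  assumes "walk G u p v"
  shows "\<exists>q. walk G v q u \<and> walk_sign G q = walk_sign G p"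
  using assms
proof (induction p arbitrary: u)
  case Nil
  then show ?case by (auto intro: exI[of _ "[]"])
next
  case (Cons d p)
  obtain e i where d: "d = (e, i)" by (cases d)
  obtain w where w: "att G e (\<not> i) = Some w" "walk G w p v" "att G e i = Some u" "e \<in> edges G"
    using Cons.prems by (auto simp: d)
  obtain q where "walk G v q w" "walk_sign G q = walk_sign G p"
    using Cons.IH[OF w(2)] by blast
  then have "walk G v (q @ [(e, \<not> i)]) u \<and> walk_sign G (q @ [(e, \<not> i)]) = walk_sign G (d # p)"
    using w by (auto simp: walk_append d)
  then show ?case by blast
qed

lemma sym_adj: "sym (adj G)"
proof (rule symI)
  fix u v assume "(u, v) \<in> adj G"
  then obtain e i where "e \<in> edges G" "att G e (\<not> i) = Some v" "att G e (\<not> \<not> i) = Some u"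
    by (auto simp: adj_def)
  then show "(v, u) \<in> adj G" unfolding adj_def by blast
qed

lemma adj_rtrancl_sym: "(u, v) \<in> (adj G)\<^sup>* \<Longrightarrow> (v, u) \<in> (adj G)\<^sup>*"
  using sym_rtrancl[OF sym_adj] by (rule symD)

lemma adj_mono: "edges H \<subseteq> edges G \<Longrightarrow> att H = att G \<Longrightarrow> adj H \<subseteq> adj G"
  unfolding adj_def by auto

lemma walk_adj_rtrancl:
  assumes "walk G u p v" "fst ` set p \<subseteq> edges H" "att H = att G"
  shows "(u, v) \<in> (adj H)\<^sup>*"
  using assms(1,2)
proof (induction p arbitrary: u)
  case (Cons d p)
  obtain e i where d: "d = (e, i)" by (cases d)
  obtain w where w: "att G e (\<not> i) = Some w" "walk G w p v" "att G e i = Some u"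
    using Cons.prems by (auto simp: d)
  have "e \<in> edges H" using Cons.prems(2) by (simp add: d)
  then have "(u, w) \<in> adj H"
    using w assms(3) by (auto simp: adj_def)
  moreover have "(w, v) \<in> (adj H)\<^sup>*"
    using Cons.IH[OF w(2)] Cons.prems(2) by simp
  ultimately show ?case by (rule converse_rtrancl_into_rtrancl)
qed simp

lemma adj_rtrancl_walk:
  assumes "(u, v) \<in> (adj G)\<^sup>*"
  shows "\<exists>p. walk G u p v"
  using assms
proof (induction rule: converse_rtrancl_induct)
  case base
  show ?case by (auto intro: exI[of _ "[]"])
next
  case (step u w)
  then obtain p e i where "walk G w p v" "e \<in> edges G" "att G e i = Some u" "att G e (\<not> i) = Some w"
    by (auto simp: adj_def)
  then have "walk G u ((e, i) # p) v" by auto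
  then show ?case by blast
qed

lemma walk_subgraph: "walk H u p v \<Longrightarrow> edges H \<subseteq> edges G \<Longrightarrow> att H = att G \<Longrightarrow> walk G u p v"
  by (induction p arbitrary: u) auto

section \<open>Switchings and balance\<close>

text \<open>
  For an edge with two attached ends this is \<open>\<sigma>\<^sup>\<nu>(e) = 1\<close>, solved for \<open>\<sigma>(e)\<close>: this form passes
  to subgraphs, and along a walk the intermediate factors cancel in pairs.
\<close>

definition positive_on :: "('v, 'e) sgraph \<Rightarrow> ('v \<Rightarrow> int) \<Rightarrow> 'e \<Rightarrow> bool" where
  "positive_on G \<nu> e \<longleftrightarrow>
     (\<forall>u v i. att G e i = Some u \<longrightarrow> att G e (\<not> i) = Some v \<longrightarrow> esign G e = \<nu> u * \<nu> v)"

lemma positive_onI: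
  assumes G: "signed_graph G" and e: "e \<in> edges G" and \<nu>: "switching G \<nu>"
    and pos: "esign (switch G \<nu>) e = 1"
  shows "positive_on G \<nu> e"
  unfolding positive_on_def
proof (intro allI impI)
  fix u v i
  assume a: "att G e i = Some u" "att G e (\<not> i) = Some v"
  have "u \<in> verts G" "v \<in> verts G" and s: "esign G e \<in> {1, -1}"
    using G e a unfolding signed_graph_def by blast+
  then have "\<nu> u \<in> {1, -1}" "\<nu> v \<in> {1, -1}" using \<nu> by (auto simp: switching_def)
  moreover have "\<nu> u * esign G e * \<nu> v = 1"
    using pos a by (cases i) (auto simp: switch_def Let_def mult_ac)
  ultimately show "esign G e = \<nu> u * \<nu> v" using s by auto
qed

lemma walk_sign_positive:
  assumes "signed_graph G" "switching G \<nu>" "walk G u p v" "u \<in> verts G"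
    and "\<And>e. e \<in> fst ` set p \<Longrightarrow> positive_on G \<nu> e"
  shows "walk_sign G p = \<nu> u * \<nu> v"
  using assms(3-)
proof (induction p arbitrary: u)
  case Nil
  then show ?case using assms(2) by (auto simp: switching_def)
next
  case (Cons d p)
  obtain e i where d: "d = (e, i)" by (cases d)
  obtain w where w: "att G e (\<not> i) = Some w" "walk G w p v" "att G e i = Some u" "e \<in> edges G"
    using Cons.prems by (auto simp: d)
  have wV: "w \<in> verts G" using w(1,4) assms(1) by (auto simp: signed_graph_def)
  have "walk_sign G p = \<nu> w * \<nu> v"
    using Cons.IH[OF w(2) wV] Cons.prems(3) by auto
  moreover have "esign G e = \<nu> u * \<nu> w"
    using Cons.prems(3)[of e] w(1,3) by (auto simp: d positive_on_def)
  moreover have "\<nu> w \<in> {1, -1}" using wV assms(2) by (auto simp: switching_def)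
  ultimately show ?case by (auto simp: d)
qed

text \<open>
  Every vertex of a circle carries exactly two ends, so its factor \<open>\<nu> v\<close> enters the product of
  the edge signs squared.
\<close>

lemma circle_sign_positive:
  assumes C: "circle C" and \<nu>: "switching C \<nu>" and pos: "\<And>e. e \<in> edges C \<Longrightarrow> positive_on C \<nu> e"
  shows "circle_sign C = 1"
proof -
  have sg: "signed_graph C" and no: "\<not> has_outer_edge C"
    and deg: "\<And>v. v \<in> verts C \<Longrightarrow> degree C v = 2"
    using C by (auto simp: circle_def)
  have fin: "finite (verts C)" "finite (edges C)" using sg by (auto simp: signed_graph_def)
  define D where "D = edges C \<times> (UNIV :: bool set)"
  have both: "\<exists>v. att C e i = Some v \<and> v \<in> verts C" if "e \<in> edges C" for e i
  proof -
    have "\<not> is_outer C e" using no that by (auto simp: has_outer_edge_def)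
    then show ?thesis using both_ends_attached[OF sg that] sg that unfolding signed_graph_def by metis
  qed
  have tv: "tail C d \<in> verts C" "att C (fst d) (snd d) = Some (tail C d)" if "d \<in> D" for d
  proof -
    have "fst d \<in> edges C" using that by (auto simp: D_def)
    then obtain v where "att C (fst d) (snd d) = Some v" "v \<in> verts C" using both by blast
    then show "tail C d \<in> verts C" "att C (fst d) (snd d) = Some (tail C d)"
      by (simp_all add: tail_def)
  qed
  have finD: "finite D" using fin by (simp add: D_def)
  have "circle_sign C = (\<Prod>e\<in>edges C. \<Prod>i\<in>(UNIV::bool set). \<nu> (tail C (e, i)))"
    unfolding circle_sign_def
  proof (rule prod.cong[OF refl])
    fix e assume e: "e \<in> edges C"
    then have "att C e True = Some (tail C (e, True))" "att C e False = Some (tail C (e, False))"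
      using tv(2)[of "(e, True)"] tv(2)[of "(e, False)"] by (auto simp: D_def)
    then show "esign C e = (\<Prod>i\<in>UNIV. \<nu> (tail C (e, i)))"
      using pos[OF e] by (auto simp: positive_on_def UNIV_bool)
  qed
  also have "\<dots> = (\<Prod>d\<in>D. \<nu> (tail C d))"
    unfolding D_def by (subst prod.cartesian_product) (simp add: case_prod_unfold)
  also have "\<dots> = (\<Prod>v\<in>verts C. \<Prod>d\<in>{d \<in> D. tail C d = v}. \<nu> (tail C d))"
    by (rule prod.group[symmetric]) (use fin finD tv in auto)
  also have "\<dots> = (\<Prod>v\<in>verts C. 1)"
  proof (rule prod.cong[OF refl])
    fix v assume v: "v \<in> verts C"
    have "{d \<in> D. tail C d = v} = {(e, i). e \<in> edges C \<and> att C e i = Some v}"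
      using tv(2) by (force simp: D_def tail_def)
    then have "card {d \<in> D. tail C d = v} = 2" using deg[OF v] by (simp add: degree_def)
    moreover have "(\<Prod>d\<in>{d \<in> D. tail C d = v}. \<nu> (tail C d)) = \<nu> v ^ card {d \<in> D. tail C d = v}"
      by simp
    moreover have "\<nu> v \<in> {1, -1}" using v \<nu> by (auto simp: switching_def)
    ultimately show "(\<Prod>d\<in>{d \<in> D. tail C d = v}. \<nu> (tail C d)) = 1" by auto
  qed
  finally show ?thesis by simp
qed

text \<open>
  A negative closed walk that repeats a vertex splits there into two closed walks, one of which is
  negative. One that traverses an edge in both directions splits into two closed walks and two
  traversals of that edge whose signs cancel. So a shortest one does neither.
\<close>

lemma negative_closed_walk_shortest:
  assumes "signed_graph G" "walk G u p u" "walk_sign G p = -1"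
  shows "\<exists>w q. walk G w q w \<and> walk_sign G q = -1 \<and> distinct (map (tail G) q) \<and>
           distinct (map fst q) \<and> set q \<subseteq> set p"
  using assms(2,3)
proof (induction "length p" arbitrary: u p rule: less_induct)
  case less
  note sgn = walk_sign_range[OF assms(1)]
  have sub: ?case if "walk G x q x" "walk_sign G q = -1" "length q < length p" "set q \<subseteq> set p" for x q
    using less.hyps[OF that(3,1,2)] that(4) by (meson order_trans)
  have split: ?case if p: "p = xs @ d # ys @ d' # zs" and t: "tail G d = tail G d'" for xs d ys d' zs
  proof -
    obtain a b where ab: "walk G u xs a" "walk G a (d # ys) b" "walk G b (d' # zs) u"
      using less.prems(1) walk_append[of G _ "d # ys" "d' # zs"]
      unfolding p walk_append[of G _ xs] by auto
    have "a = b" using t walk_Cons_tail[OF ab(2)] walk_Cons_tail[OF ab(3)] by simp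
    then have w: "walk G a (d # ys) a" "walk G u (xs @ d' # zs) u"
      using ab by (auto simp: walk_append)
    have "walk_sign G p = walk_sign G (d # ys) * walk_sign G (xs @ d' # zs)" by (simp add: p)
    then have "walk_sign G (d # ys) = -1 \<or> walk_sign G (xs @ d' # zs) = -1"
      using sgn[OF w(1)] sgn[OF w(2)] less.prems(2) by auto
    then show ?case
      using sub[OF w(1)] sub[OF w(2)] by (auto simp: p)
  qed
  show ?case
  proof (cases "distinct (map (tail G) p) \<and> distinct (map fst p)")
    case True
    then show ?thesis using less.prems by blast
  next
    case False
    then consider "\<not> distinct (map (tail G) p)" | "\<not> distinct (map fst p)" by blast
    then show ?thesis
    proof cases
      case 1
      then obtain as x bs cs where "map (tail G) p = as @ [x] @ bs @ [x] @ cs"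
        using not_distinct_decomp by blast
      then obtain xs d ys d' zs where "p = xs @ d # ys @ d' # zs" "tail G d = x" "tail G d' = x"
        by (auto simp: map_eq_append_conv map_eq_Cons_conv append_eq_map_conv Cons_eq_map_conv)
      then show ?thesis using split[of xs d ys d' zs] by simp
    next
      case 2
      then obtain as x bs cs where "map fst p = as @ [x] @ bs @ [x] @ cs"
        using not_distinct_decomp by blast
      then obtain xs d ys d' zs where p: "p = xs @ d # ys @ d' # zs" and x: "fst d = x" "fst d' = x"
        by (auto simp: map_eq_append_conv map_eq_Cons_conv append_eq_map_conv Cons_eq_map_conv)
      show ?thesis
      proof (cases "snd d = snd d'")
        case True
        then show ?thesis using split[OF p] x by (simp add: tail_def)
      next
        case False
        define i where "i = snd d"
        have d: "d = (x, i)" "d' = (x, \<not> i)" using x False by (auto simp: i_def prod_eq_iff)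
        have wp: "walk G u (xs @ (x, i) # ys @ (x, \<not> i) # zs) u"
          using less.prems(1) by (simp add: p d)
        obtain a b where w: "walk G u xs a" "walk G b ys b" "walk G a zs u"
          and e: "x \<in> edges G" "att G x i = Some a" "att G x (\<not> i) = Some b"
          using wp by (auto simp: walk_append)
        have "esign G x \<in> {1, -1}" using assms(1) e(1) by (auto simp: signed_graph_def)
        moreover have w': "walk G u (xs @ zs) u" using w by (auto simp: walk_append)
        ultimately have "walk_sign G ys = -1 \<or> walk_sign G (xs @ zs) = -1"
          using less.prems(2) sgn[OF w(2)] sgn[OF w'] by (auto simp: p d)
        then show ?thesis using sub[OF w(2)] sub[OF w'] by (auto simp: p)
      qed
    qed
  qed
qed

text \<open>
  A shortest negative closed walk runs through distinct edges and distinct vertices, so its edges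
  form a circle: the two ends at a vertex are the one through which the walk leaves it and the one
  through which the walk enters it.
\<close>

lemma negative_closed_walk_circle:
  assumes G: "signed_graph G" and "walk G u p u" "walk_sign G p = -1"
  shows "\<exists>C. subgraph C G \<and> circle C \<and> circle_sign C = -1 \<and> edges C \<subseteq> fst ` set p"
proof -
  obtain w q where q: "walk G w q w" "walk_sign G q = -1" "distinct (map (tail G) q)"
    "distinct (map fst q)" "set q \<subseteq> set p"
    using negative_closed_walk_shortest[OF assms] by blast
  have ne: "q \<noteq> []" using q(2) by auto
  define C where "C = \<lparr>verts = tail G ` set q, edges = fst ` set q, att = att G, esign = esign G\<rparr>"
  have [simp]: "verts C = tail G ` set q" "edges C = fst ` set q" "att C = att G" "esign C = esign G"
    by (simp_all add: C_def)
  note dart = walk_dart[OF q(1)]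
  \<comment> \<open>As the walk is closed, the next vertex of each dart is the starting vertex of its cyclic successor.\<close>
  have rot: "map (head G) q = rotate1 (map (tail G) q)"
    using walk_heads[OF q(1)] ne by (cases q) auto
  then have dh: "distinct (map (head G) q)" using q(3) by simp
  have hv: "head G ` set q = tail G ` set q" using rot by (metis list.set_map set_rotate1)
  have ends: "(\<exists>d\<in>set q. fst d = e \<and> (i = snd d \<and> v = tail G d \<or> i = (\<not> snd d) \<and> v = head G d))"
    if "e \<in> edges C" "att G e i = Some v" for e i v
  proof -
    have "e \<in> fst ` set q" using that(1) by simp
    then obtain d where d: "d \<in> set q" "e = fst d" by blast
    show ?thesis using dart(2,3)[OF d(1)] that d by (cases "i = snd d") (auto intro!: bexI[of _ d])
  qed
  have sg: "signed_graph C"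
    unfolding signed_graph_def
  proof (intro conjI ballI allI impI)
    fix e assume e: "e \<in> edges C"
    then obtain d where d: "d \<in> set q" "e = fst d" by auto
    show "\<exists>i. att C e i \<noteq> None" using dart(2)[OF d(1)] d by auto
    show "esign C e \<in> {1, -1}" using dart(1)[OF d(1)] d G by (auto simp: signed_graph_def)
    fix i v assume "att C e i = Some v"
    then show "v \<in> verts C" using ends[OF e] hv by fastforce
  qed auto
  have sub: "subgraph C G"
    using sg G dart(1,2) unfolding subgraph_def signed_graph_def by fastforce
  have conn: "graph_connected C"
  proof -
    have "(w, v) \<in> (adj C)\<^sup>*" if "v \<in> verts C" for v
    proof -
      obtain d where "d \<in> set q" "v = tail G d" using \<open>v \<in> verts C\<close> by auto
      then obtain xs ys where xs: "q = xs @ d # ys" "v = tail G d" by (auto dest: split_list)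
      obtain a where "walk G w xs a" "walk G a (d # ys) w" using q(1) by (auto simp: xs walk_append)
      then have "walk G w xs v" using xs walk_Cons_tail by metis
      then show ?thesis by (rule walk_adj_rtrancl) (auto simp: xs)
    qed
    then show ?thesis
      using ne by (auto simp: graph_connected_def intro: rtrancl_trans adj_rtrancl_sym)
  qed
  have "degree C v = 2" if v: "v \<in> verts C" for v
  proof -
    obtain d where d: "d \<in> set q" "tail G d = v" using v by auto
    have "v \<in> head G ` set q" using v hv by simp
    then obtain d' where d': "d' \<in> set q" "head G d' = v" by blast
    have "{(e, i). e \<in> edges C \<and> att C e i = Some v} = {d, (fst d', \<not> snd d')}"
    proof (intro equalityI subsetI)
      fix x assume "x \<in> {(e, i). e \<in> edges C \<and> att C e i = Some v}"
      then obtain e i where x: "x = (e, i)" "e \<in> edges C" "att G e i = Some v" by auto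
      obtain f where f: "f \<in> set q" "fst f = e"
        "i = snd f \<and> v = tail G f \<or> i = (\<not> snd f) \<and> v = head G f"
        using ends[OF x(2,3)] by blast
      from f(3) show "x \<in> {d, (fst d', \<not> snd d')}"
      proof
        assume "i = snd f \<and> v = tail G f"
        then have "f = d" using d f q(3) by (auto simp: distinct_map dest: inj_onD)
        then have "x = d" using x f \<open>i = snd f \<and> v = tail G f\<close> by (simp add: prod_eq_iff)
        then show ?thesis by simp
      next
        assume "i = (\<not> snd f) \<and> v = head G f"
        then have "f = d'" using d' f dh by (auto simp: distinct_map dest: inj_onD)
        then show ?thesis using x f \<open>i = (\<not> snd f) \<and> v = head G f\<close> by auto
      qed
    next
      fix x assume "x \<in> {d, (fst d', \<not> snd d')}"
      then show "x \<in> {(e, i). e \<in> edges C \<and> att C e i = Some v}"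
        using dart(2)[OF d(1)] dart(3)[OF d'(1)] d d' by (auto simp: case_prod_unfold)
    qed
    moreover have "d \<noteq> (fst d', \<not> snd d')"
    proof
      assume a: "d = (fst d', \<not> snd d')"
      then have "d = d'" using q(4) d(1) d'(1) by (auto simp: distinct_map inj_on_def)
      then show False using a by (metis snd_conv)
    qed
    ultimately show ?thesis by (simp add: degree_def)
  qed
  moreover have "\<not> has_outer_edge C"
  proof
    assume "has_outer_edge C"
    then have "\<exists>e\<in>fst ` set q. is_outer G e" by (simp add: has_outer_edge_def is_outer_def)
    then obtain d where d: "d \<in> set q" "is_outer G (fst d)" by blast
    have "att G (fst d) (snd d) \<noteq> None" "att G (fst d) (\<not> snd d) \<noteq> None"
      using dart(2,3)[OF d(1)] by auto
    then show False using d(2) unfolding is_outer_def by blast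
  qed
  ultimately have "circle C" using sg conn by (simp add: circle_def)
  moreover have "circle_sign C = walk_sign G q"
    using q(4) prod.distinct_set_conv_list[of "map fst q" "esign G"]
    by (simp add: circle_sign_def walk_sign_def)
  ultimately show ?thesis using sub q(2,5) by (intro exI[of _ C]) auto
qed

section \<open>Components\<close>

text \<open>
  Every vertex \<open>v\<close> is assigned a representative \<open>rep G v\<close> of its connectedness class. The
  representatives, the \<open>roots\<close>, index the components; the coordinate of a 0-chain at a root will
  record what the boundary operator sees of the whole component.
\<close>

definition rep :: "('v, 'e) sgraph \<Rightarrow> 'v \<Rightarrow> 'v" where
  "rep G v = (SOME w. (v, w) \<in> (adj G)\<^sup>*)"

definition component_at :: "('v, 'e) sgraph \<Rightarrow> 'v \<Rightarrow> ('v, 'e) sgraph" where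
  "component_at G r = \<lparr>verts = {v \<in> verts G. rep G v = r},
     edges = {e \<in> edges G. \<exists>i v. att G e i = Some v \<and> rep G v = r},
     att = att G, esign = esign G\<rparr>"

definition roots :: "('v, 'e) sgraph \<Rightarrow> 'v set" where
  "roots G = {r \<in> verts G. rep G r = r}"

lemma component_at_simps [simp]:
  "verts (component_at G r) = {v \<in> verts G. rep G v = r}"
  "edges (component_at G r) = {e \<in> edges G. \<exists>i v. att G e i = Some v \<and> rep G v = r}"
  "att (component_at G r) = att G" "esign (component_at G r) = esign G"
  by (simp_all add: component_at_def)

lemma rep_adj_rtrancl: "(v, rep G v) \<in> (adj G)\<^sup>*"
  unfolding rep_def by (rule someI[of _ v]) simp

lemma rep_eq_iff: "rep G u = rep G v \<longleftrightarrow> (u, v) \<in> (adj G)\<^sup>*"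
proof
  assume "rep G u = rep G v"
  then show "(u, v) \<in> (adj G)\<^sup>*"
    using rep_adj_rtrancl[of u G] adj_rtrancl_sym[OF rep_adj_rtrancl[of v G]] by (metis rtrancl_trans)
next
  assume "(u, v) \<in> (adj G)\<^sup>*"
  then have "(u, w) \<in> (adj G)\<^sup>* \<longleftrightarrow> (v, w) \<in> (adj G)\<^sup>*" for w
    by (meson adj_rtrancl_sym rtrancl_trans)
  then show "rep G u = rep G v" by (simp add: rep_def)
qed

lemma rep_rep [simp]: "rep G (rep G v) = rep G v"
  by (metis rep_eq_iff rep_adj_rtrancl)

lemma rep_edge:
  assumes "e \<in> edges G" "att G e i = Some u" "att G e j = Some v"
  shows "rep G u = rep G v"
proof (cases "i = j")
  case False
  then have "j = (\<not> i)" by blast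
  then have "(u, v) \<in> adj G" using assms by (auto simp: adj_def)
  then show ?thesis by (auto simp: rep_eq_iff)
qed (use assms in auto)

lemma rep_in_verts: "signed_graph G \<Longrightarrow> v \<in> verts G \<Longrightarrow> rep G v \<in> verts G"
  using adj_rtrancl_walk[OF rep_adj_rtrancl] walk_verts by metis

lemma rep_in_roots: "signed_graph G \<Longrightarrow> v \<in> verts G \<Longrightarrow> rep G v \<in> roots G"
  by (simp add: roots_def rep_in_verts)

lemma subgraph_comp: "signed_graph G \<Longrightarrow> subgraph (component_at G r) G"
  unfolding subgraph_def signed_graph_def by (auto intro: rep_edge)

lemma walk_comp: "walk G u p v \<Longrightarrow> rep G u = r \<Longrightarrow> walk (component_at G r) u p v"
proof (induction p arbitrary: u)
  case (Cons d p)
  obtain e i where d: "d = (e, i)" by (cases d)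
  obtain w where w: "att G e (\<not> i) = Some w" "walk G w p v" "att G e i = Some u" "e \<in> edges G"
    using Cons.prems by (auto simp: d)
  have "rep G w = r" using rep_edge[OF w(4,1,3)] Cons.prems(2) by simp
  then show ?case using Cons.IH[OF w(2)] w Cons.prems(2) by (auto simp: d)
qed simp

lemma graph_connected_comp:
  assumes "r \<in> roots G"
  shows "graph_connected (component_at G r)"
  unfolding graph_connected_def
proof (intro conjI ballI)
  show "verts (component_at G r) \<noteq> {}" using assms by (auto simp: roots_def)
  fix u v assume uv: "u \<in> verts (component_at G r)" "v \<in> verts (component_at G r)"
  then have "(u, v) \<in> (adj G)\<^sup>*" by (simp flip: rep_eq_iff)
  then obtain p where "walk G u p v" using adj_rtrancl_walk by metis
  then have w: "walk (component_at G r) u p v" using uv by (simp add: walk_comp)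
  show "(u, v) \<in> (adj (component_at G r))\<^sup>*"
    by (rule walk_adj_rtrancl[OF w]) (use walk_dart(1)[OF w] in auto)
qed

lemma connected_subgraph_comp:
  assumes H: "subgraph H G" "graph_connected H" and v: "v \<in> verts H"
  shows "subgraph H (component_at G (rep G v))"
proof -
  have rep: "rep G u = rep G v" if "u \<in> verts H" for u
  proof -
    have "(u, v) \<in> (adj H)\<^sup>*" using H that v by (simp add: graph_connected_def)
    moreover have "adj H \<subseteq> adj G" using H(1) by (intro adj_mono) (auto simp: subgraph_def)
    ultimately show ?thesis unfolding rep_eq_iff by (meson rtrancl_mono subsetD)
  qed
  have "e \<in> edges (component_at G (rep G v))" if e: "e \<in> edges H" for e
  proof -
    obtain i u where "att G e i = Some u" "u \<in> verts H"
      using H(1) e unfolding subgraph_def signed_graph_def by (metis option.exhaust)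
    then show ?thesis using rep H(1) e by (auto simp: subgraph_def)
  qed
  then show ?thesis using H(1) rep by (auto simp: subgraph_def)
qed

lemma subgraph_antisym: "subgraph H K \<Longrightarrow> subgraph K H \<Longrightarrow> H = K"
  by (rule sgraph.equality) (auto simp: subgraph_def)

text \<open>
  A component contains all edges attached to its vertex class, outer-edges included, since adding
  such an edge keeps a subgraph connected.
\<close>

lemma components_eq:
  assumes G: "signed_graph G"
  shows "components G = component_at G ` roots G"
proof (intro equalityI subsetI)
  fix H assume "H \<in> components G"
  then have H: "subgraph H G" "graph_connected H"
    and max: "\<And>H'. subgraph H' G \<Longrightarrow> graph_connected H' \<Longrightarrow> subgraph H H' \<Longrightarrow> H' = H"
    by (auto simp: components_def)
  then obtain v where v: "v \<in> verts H" by (auto simp: graph_connected_def)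
  then have r: "rep G v \<in> roots G" using G H(1) by (auto simp: subgraph_def intro: rep_in_roots)
  have "component_at G (rep G v) = H"
    by (intro max subgraph_comp G graph_connected_comp r connected_subgraph_comp H v)
  then show "H \<in> component_at G ` roots G" using r by blast
next
  fix K assume "K \<in> component_at G ` roots G"
  then obtain r where r: "r \<in> roots G" "K = component_at G r" by blast
  have "H' = component_at G r" if H': "subgraph H' G" "graph_connected H'" "subgraph (component_at G r) H'" for H'
  proof -
    have "r \<in> verts H'" using r H'(3) by (auto simp: roots_def subgraph_def)
    then have "subgraph H' (component_at G r)"
      using connected_subgraph_comp[OF H'(1,2), of r] r(1) by (simp add: roots_def)
    then show ?thesis using H'(3) subgraph_antisym by blast
  qed
  then show "K \<in> components G"
    using r subgraph_comp[OF G] graph_connected_comp by (auto simp: components_def)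
qed

lemma inj_on_comp: "inj_on (component_at G) (roots G)"
proof (rule inj_onI)
  fix r s assume "r \<in> roots G" "s \<in> roots G" "component_at G r = component_at G s"
  then have "r \<in> verts (component_at G s)" by (metis (mono_tags) component_at_simps(1) mem_Collect_eq roots_def)
  then show "r = s" using \<open>r \<in> roots G\<close> by (simp add: roots_def)
qed

lemma card_components:
  "signed_graph G \<Longrightarrow> card {H \<in> components G. P H} = card {r \<in> roots G. P (component_at G r)}"
proof -
  assume "signed_graph G"
  then have "{H \<in> components G. P H} = component_at G ` {r \<in> roots G. P (component_at G r)}"
    by (auto simp: components_eq)
  then show ?thesis by (simp add: card_image inj_on_subset[OF inj_on_comp])
qed

lemma connected_component:
  assumes G: "signed_graph G" "graph_connected G" and r: "r \<in> roots G"
  shows "component_at G r = G" "roots G = {r}"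
proof -
  have rep: "rep G v = r" if "v \<in> verts G" for v
  proof -
    have "(v, r) \<in> (adj G)\<^sup>*" using G(2) that r by (simp add: roots_def graph_connected_def)
    then have "rep G v = rep G r" unfolding rep_eq_iff .
    then show ?thesis using r by (simp add: roots_def)
  qed
  then show "roots G = {r}" using r by (auto simp: roots_def)
  have "\<exists>i v. att G e i = Some v \<and> v \<in> verts G" if "e \<in> edges G" for e
    using G(1) that unfolding signed_graph_def by (metis option.exhaust)
  then show "component_at G r = G" using rep by (intro sgraph.equality) fastforce+
qed

text \<open>
  An unbalanced component has no switching that makes all its edges positive, but every component
  has one that makes a spanning tree positive. What such a switching provides, and all that transport
  to the root uses, is a positive walk from each vertex to its root.
\<close>

definition gauge :: "('v, 'e) sgraph \<Rightarrow> ('v \<Rightarrow> int) \<Rightarrow> bool" where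
  "gauge G \<nu> \<longleftrightarrow> switching G \<nu> \<and>
     (\<forall>v\<in>verts G. \<exists>p. walk G v p (rep G v) \<and> walk_sign G p = \<nu> v * \<nu> (rep G v))"

lemma gauge_exists:
  assumes G: "signed_graph G"
  shows "\<exists>\<nu>. gauge G \<nu>"
proof -
  obtain P where P: "\<And>v. walk G v (P v) (rep G v)"
    using adj_rtrancl_walk[OF rep_adj_rtrancl] by metis
  define \<nu> where "\<nu> v = (if rep G v = v then 1 else walk_sign G (P v))" for v
  have "\<exists>p. walk G v p (rep G v) \<and> walk_sign G p = \<nu> v * \<nu> (rep G v)" for v
  proof (cases "rep G v = v")
    case True
    then show ?thesis by (intro exI[of _ "[]"]) (simp add: \<nu>_def)
  next
    case False
    then show ?thesis using P by (intro exI[of _ "P v"]) (simp add: \<nu>_def)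
  qed
  moreover have "switching G \<nu>" using walk_sign_range[OF G P] by (auto simp: switching_def \<nu>_def)
  ultimately show ?thesis by (auto simp: gauge_def)
qed

lemma gauge_if_positive_on_connected_spanning:
  assumes G: "signed_graph G" and \<nu>: "switching G \<nu>"
    and H: "subgraph H G" "verts H = verts G" "graph_connected H"
    and pos: "\<And>e. e \<in> edges H \<Longrightarrow> positive_on G \<nu> e"
  shows "gauge G \<nu>"
  unfolding gauge_def
proof (intro conjI ballI \<nu>)
  fix v assume v: "v \<in> verts G"
  then have "(v, rep G v) \<in> (adj H)\<^sup>*"
    using H G rep_in_verts[OF G v] by (simp add: graph_connected_def)
  then obtain p where p: "walk H v p (rep G v)" using adj_rtrancl_walk by metis
  then have w: "walk G v p (rep G v)" using H(1) by (auto simp: subgraph_def intro: walk_subgraph)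
  have "walk_sign G p = \<nu> v * \<nu> (rep G v)"
    by (rule walk_sign_positive[OF G \<nu> w v]) (use walk_dart(1)[OF p] pos in auto)
  then show "\<exists>p. walk G v p (rep G v) \<and> walk_sign G p = \<nu> v * \<nu> (rep G v)" using w by blast
qed

text \<open>
  An edge \<open>uv\<close>, together with walks to the root that become positive, closes up to a walk of sign
  \<open>\<nu>(u) \<sigma>(e) \<nu>(v)\<close>.
\<close>

lemma gauge_positive_on:
  assumes G: "signed_graph G" and \<nu>: "gauge G \<nu>"
    and cl: "\<And>p. walk G r p r \<Longrightarrow> walk_sign G p = 1" and e: "e \<in> edges (component_at G r)"
  shows "positive_on G \<nu> e"
  unfolding positive_on_def
proof (intro allI impI)
  fix u v i
  assume a: "att G e i = Some u" "att G e (\<not> i) = Some v"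
  have eG: "e \<in> edges G" using e by simp
  obtain j x where "att G e j = Some x" "rep G x = r" using e by auto
  then have ru: "rep G u = r" using rep_edge[OF eG a(1)] by simp
  have rv: "rep G v = r" using rep_edge[OF eG a] ru by simp
  have V: "u \<in> verts G" "v \<in> verts G" "r \<in> verts G" and s: "esign G e \<in> {1, -1}"
    using G eG a rep_in_verts[OF G, of u] ru unfolding signed_graph_def by blast+
  obtain p where p: "walk G u p r" "walk_sign G p = \<nu> u * \<nu> r"
    using \<nu> V(1) ru unfolding gauge_def by blast
  obtain p' where p': "walk G r p' u" "walk_sign G p' = \<nu> u * \<nu> r"
    using walk_reverse[OF p(1)] p(2) by auto
  obtain q where q: "walk G v q r" "walk_sign G q = \<nu> v * \<nu> r"
    using \<nu> V(2) rv unfolding gauge_def by blast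
  have "walk G r (p' @ (e, i) # q) r" using p'(1) q(1) a eG by (auto simp: walk_append)
  then have "\<nu> u * \<nu> r * (esign G e * (\<nu> v * \<nu> r)) = 1" using cl p'(2) q(2) by fastforce
  moreover have "\<nu> u \<in> {1, -1}" "\<nu> v \<in> {1, -1}" "\<nu> r \<in> {1, -1}"
    using \<nu> V by (auto simp: gauge_def switching_def)
  ultimately show "esign G e = \<nu> u * \<nu> v" using s by auto
qed

text \<open>
  If all closed walks at the root are positive, every switching of the above kind is positive on the
  whole component, so all circles are positive. Conversely, a negative closed walk contains a
  negative circle.
\<close>

lemma balanced_comp_iff:
  assumes G: "signed_graph G"
  shows "balanced (component_at G r) \<longleftrightarrow>
    \<not> has_outer_edge (component_at G r) \<and> (\<forall>p. walk G r p r \<longrightarrow> rep G r = r \<longrightarrow> walk_sign G p = 1)"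
    (is "_ \<longleftrightarrow> _ \<and> ?closed")
proof -
  have sgc: "signed_graph (component_at G r)" using subgraph_comp[OF G] by (simp add: subgraph_def)
  have "walk_sign G p = 1" if b: "balanced (component_at G r)" and w: "walk G r p r" "rep G r = r" for p
  proof (rule ccontr)
    assume "walk_sign G p \<noteq> 1"
    then have "walk_sign (component_at G r) p = -1"
      using walk_sign_range[OF G w(1)] by (simp add: walk_sign_def)
    from negative_closed_walk_circle[OF sgc walk_comp[OF w] this]
    show False using b by (auto simp: balanced_def)
  qed
  moreover have "circle_sign C = 1"
    if cl: ?closed and C: "subgraph C (component_at G r)" "circle C" for C
  proof -
    obtain \<nu> where \<nu>: "gauge G \<nu>" using gauge_exists[OF G] by blast
    have r: "rep G r = r" using C by (auto simp: subgraph_def circle_def graph_connected_def)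
    show ?thesis
    proof (rule circle_sign_positive[OF C(2)])
      show "switching C \<nu>" using \<nu> C(1) by (auto simp: gauge_def switching_def subgraph_def)
      fix e assume "e \<in> edges C"
      then have "e \<in> edges (component_at G r)" using C(1) by (auto simp: subgraph_def)
      then have "positive_on G \<nu> e" using gauge_positive_on[OF G \<nu>] cl r by blast
      then show "positive_on C \<nu> e" using C(1) by (simp add: positive_on_def subgraph_def)
    qed
  qed
  ultimately show ?thesis unfolding balanced_def by blast
qed

section \<open>Finite products in an abelian group\<close>

context comm_group
begin

lemma finprod_int_pow:
  "f \<in> I \<rightarrow> carrier G \<Longrightarrow> (\<Otimes>i\<in>I. f i) [^] (k :: int) = (\<Otimes>i\<in>I. f i [^] k)"
proof (induction I rule: infinite_finite_induct)
  case (insert i I)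
  then show ?case by (simp add: Pi_iff int_pow_distrib)
qed auto

lemma int_pow_sum:
  "finite I \<Longrightarrow> x \<in> carrier G \<Longrightarrow> (\<Otimes>i\<in>I. x [^] (k i :: int)) = x [^] (\<Sum>i\<in>I. k i)"
  by (induction I rule: finite_induct) (auto simp: int_pow_mult)

lemma finprod_swap:
  assumes "finite I" "\<And>i j. i \<in> I \<Longrightarrow> j \<in> J \<Longrightarrow> f i j \<in> carrier G"
  shows "(\<Otimes>i\<in>I. \<Otimes>j\<in>J. f i j) = (\<Otimes>j\<in>J. \<Otimes>i\<in>I. f i j)"
  using assms
proof (induction I rule: finite_induct)
  case (insert i I)
  have "(\<Otimes>j\<in>J. \<Otimes>i\<in>insert i I. f i j) = (\<Otimes>j\<in>J. f i j \<otimes> (\<Otimes>i\<in>I. f i j))"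
    using insert by (intro finprod_cong') auto
  also have "\<dots> = (\<Otimes>j\<in>J. f i j) \<otimes> (\<Otimes>j\<in>J. \<Otimes>i\<in>I. f i j)"
    using insert by (intro finprod_multf) auto
  finally show ?case using insert by (simp add: Pi_iff)
qed simp

lemma finprod_in_subgroup:
  assumes "subgroup H G" "\<And>i. i \<in> I \<Longrightarrow> f i \<in> H"
  shows "(\<Otimes>i\<in>I. f i) \<in> H"
  using assms(2)
proof (induction I rule: infinite_finite_induct)
  case (insert i I)
  have "H \<subseteq> carrier G" using assms(1) by (rule subgroup.subset)
  then have "(\<Otimes>i\<in>insert i I. f i) = f i \<otimes> (\<Otimes>i\<in>I. f i)"
    using insert by (intro finprod_insert) auto
  then show ?case using insert assms(1) by (simp add: subgroup.m_closed)
qed (auto simp: assms(1) subgroup.one_closed)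

lemma finprod_delta:
  assumes "finite I" "f i \<in> carrier G"
  shows "(\<Otimes>j\<in>I. if j = i then f j else \<one>) = (if i \<in> I then f i else \<one>)"
proof (cases "i \<in> I")
  case True
  have "(\<Otimes>j\<in>I. if j = i then f j else \<one>) = (\<Otimes>j\<in>{i}. f j)"
    by (rule finprod_mono_neutral_cong_right) (use assms True in auto)
  also have "\<dots> = f i" using assms(2) by simp
  finally show ?thesis using True by simp
qed (auto intro: finprod_one_eqI)

end

lemma subgroup_twice:
  fixes A :: "'a monoid" (structure)
  assumes "comm_group A"
  shows "subgroup (carrier (twice A)) A"
proof -
  interpret comm_group A by fact
  show ?thesis
  proof (rule subgroup.intro)
    fix x y assume "x \<in> carrier (twice A)" "y \<in> carrier (twice A)"
    then obtain a b where "x = a [^] (2::int)" "y = b [^] (2::int)" "a \<in> carrier A" "b \<in> carrier A"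
      by (auto simp: twice_def)
    then have "x \<otimes> y = (a \<otimes> b) [^] (2::int)" "a \<otimes> b \<in> carrier A" by (auto simp: int_pow_distrib)
    then show "x \<otimes> y \<in> carrier (twice A)" by (auto simp: twice_def)
  next
    show "\<one> \<in> carrier (twice A)" by (auto simp: twice_def intro!: exI[of _ \<one>])
  next
    fix x assume "x \<in> carrier (twice A)"
    then obtain a where "x = a [^] (2::int)" "a \<in> carrier A" by (auto simp: twice_def)
    then have "inv x = (inv a) [^] (2::int)" "inv a \<in> carrier A" by (auto simp: int_pow_inv)
    then show "inv x \<in> carrier (twice A)" by (auto simp: twice_def)
  qed (auto simp: twice_def)
qed

section \<open>The image of the boundary operator\<close>

text \<open>
  The incidence number is the sum of the arrows on the ends attached to \<open>v\<close>. This covers loops as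
  well: the two arrows agree on a negative loop, giving \<open>\<plusminus>2\<close>, and cancel on a positive one. The end
  \<open>i\<close> is a parameter so that either end of the edge can be taken as the first one.
\<close>

lemma incidence_arc:
  assumes "(e, d) \<in> arcs G"
  shows "incidence G v (e, d) =
    (if att G e i = Some v then d i else 0) + (if att G e (\<not> i) = Some v then d (\<not> i) else 0)"
proof -
  have "d True \<in> {1, -1}" "d False \<in> {1, -1}" "d True * d False = - esign G e"
    using assms by (auto simp: arcs_def)
  then show ?thesis by (cases i) (auto simp: is_loop_def)
qed

locale signed_graph_coeff = comm_group A for A :: "'a monoid" (structure) +
  fixes G :: "('v, 'e) sgraph"
  assumes signed_graph: "signed_graph G"
begin

lemma finite_verts: "finite (verts G)" and finite_edges: "finite (edges G)"
  using signed_graph by (auto simp: signed_graph_def)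

lemma esign_range: "e \<in> edges G \<Longrightarrow> esign G e \<in> {1, -1}"
  using signed_graph by (auto simp: signed_graph_def)

lemma att_verts: "e \<in> edges G \<Longrightarrow> att G e i = Some v \<Longrightarrow> v \<in> verts G"
  using signed_graph unfolding signed_graph_def by blast

lemma some_arc:
  assumes "e \<in> edges G"
  shows "some_arc G e \<in> arcs G" "fst (some_arc G e) = e"
proof -
  have "\<exists>a. a \<in> arcs G \<and> fst a = e" using arcs_of_edge[OF signed_graph assms] by blast
  from someI_ex[OF this] show "some_arc G e \<in> arcs G" "fst (some_arc G e) = e"
    by (auto simp: some_arc_def)
qed

definition arrow :: "'e \<Rightarrow> bool \<Rightarrow> int" where
  "arrow e = snd (some_arc G e)"

definition coef :: "'v \<Rightarrow> 'e \<Rightarrow> int" where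
  "coef v e = incidence G v (some_arc G e)"

lemma arrow:
  assumes "e \<in> edges G"
  shows "arrow e i \<in> {1, -1}" "arrow e i * arrow e (\<not> i) = - esign G e"
proof -
  have "(e, arrow e) \<in> arcs G" using some_arc[OF assms] by (metis arrow_def prod.collapse)
  then show "arrow e i \<in> {1, -1}" "arrow e i * arrow e (\<not> i) = - esign G e"
    by (cases i; auto simp: arcs_def mult.commute)+
qed

lemma coef_eq:
  assumes "e \<in> edges G"
  shows "coef v e = (if att G e i = Some v then arrow e i else 0) +
                    (if att G e (\<not> i) = Some v then arrow e (\<not> i) else 0)"
proof -
  have "some_arc G e = (e, arrow e)" using some_arc[OF assms] by (metis arrow_def prod.collapse)
  then show ?thesis using incidence_arc some_arc(1)[OF assms] by (metis coef_def)
qed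

text \<open>
  A chain is determined by its values on one arc of each edge, and those values are arbitrary.
\<close>

definition bd :: "('e \<Rightarrow> 'a) \<Rightarrow> 'v \<Rightarrow> 'a" where
  "bd x = (\<lambda>v\<in>verts G. \<Otimes>e\<in>edges G. x e [^] coef v e)"

abbreviation B :: "('v \<Rightarrow> 'a) set" where
  "B \<equiv> carrier (B0 G A)"

lemma B_eq: "B = bd ` (edges G \<rightarrow> carrier A)"
proof (intro equalityI subsetI)
  fix b assume "b \<in> B"
  then obtain c where c: "c \<in> carrier (C1 G A)" "b = boundary G A c" by (auto simp: B0_def)
  have "(\<lambda>e. c (some_arc G e)) \<in> edges G \<rightarrow> carrier A"
    using c(1) some_arc(1) by (auto simp: C1_def)
  moreover have "b = bd (\<lambda>e. c (some_arc G e))" by (simp add: c(2) boundary_def bd_def coef_def)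
  ultimately show "b \<in> bd ` (edges G \<rightarrow> carrier A)" by blast
next
  fix b assume "b \<in> bd ` (edges G \<rightarrow> carrier A)"
  then obtain x where x: "x \<in> edges G \<rightarrow> carrier A" "b = bd x" by blast
  \<comment> \<open>Antisymmetry dictates the value on the other orientation of each edge.\<close>
  define c where "c = (\<lambda>a\<in>arcs G. if a = some_arc G (fst a) then x (fst a) else inv (x (fst a)))"
  have arcs: "fst a \<in> edges G" if "a \<in> arcs G" for a using that by (auto simp: arcs_def)
  have inv_arc: "arc_inv a \<in> arcs G" if "a \<in> arcs G" for a
    using that by (auto simp: arcs_def arc_inv_def)
  have "c (arc_inv a) = inv (c a)" if a: "a \<in> arcs G" for a
  proof -
    obtain a0 where a0: "{b \<in> arcs G. fst b = fst a} = {a0, arc_inv a0}" "a0 \<noteq> arc_inv a0"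
      using arcs_of_edge[OF signed_graph arcs[OF a]] by blast
    obtain a1 where a1: "arc_inv a0 = a1" "arc_inv a1 = a0" by (simp add: arc_inv_def)
    have "a \<in> {b \<in> arcs G. fst b = fst a}" "some_arc G (fst a) \<in> {b \<in> arcs G. fst b = fst a}"
      using a some_arc[OF arcs[OF a]] by simp_all
    then have "a \<in> {a0, a1}" "some_arc G (fst a) \<in> {a0, a1}" "a0 \<noteq> a1"
      using a0 a1(1) by simp_all
    then have "arc_inv a = some_arc G (fst a) \<longleftrightarrow> a \<noteq> some_arc G (fst a)"
      using a1 by (elim insertE emptyE) simp_all
    moreover have "fst (arc_inv a) = fst a" by (simp add: arc_inv_def)
    moreover have "x (fst a) \<in> carrier A" using x(1) arcs[OF a] by auto
    ultimately show ?thesis using a inv_arc[OF a] by (simp add: c_def)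
  qed
  moreover have "c a \<in> carrier A" if a: "a \<in> arcs G" for a
  proof -
    have "x (fst a) \<in> carrier A" using x(1) arcs[OF a] by auto
    then show ?thesis using a by (simp add: c_def)
  qed
  moreover have "c a = undefined" if "a \<notin> arcs G" for a using that by (simp add: c_def)
  ultimately have "c \<in> carrier (C1 G A)" by (simp add: C1_def PiE_def Pi_def extensional_def)
  moreover have "bd x = boundary G A c"
    unfolding bd_def boundary_def
  proof (intro restrict_ext finprod_cong')
    fix v e assume e: "e \<in> edges G"
    then show "x e [^] coef v e = c (some_arc G e) [^] incidence G v (some_arc G e)"
      using some_arc[OF e] by (simp add: c_def coef_def)
  next
    show "(\<lambda>e. c (some_arc G e) [^] incidence G v (some_arc G e)) \<in> edges G \<rightarrow> carrier A" for v
      using x(1) some_arc by (auto simp: c_def Pi_iff)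
  qed auto
  ultimately show "b \<in> B" using x(2) by (auto simp: B0_def)
qed

lemma B_closed: "b \<in> B \<Longrightarrow> b \<in> verts G \<rightarrow>\<^sub>E carrier A"
  unfolding B_eq bd_def by (auto simp: Pi_iff)

lemma B_one: "(\<lambda>v\<in>verts G. \<one>) \<in> B"
proof -
  have "bd (\<lambda>_. \<one>) = (\<lambda>v\<in>verts G. \<one>)" by (simp add: bd_def)
  then show ?thesis unfolding B_eq by (metis (no_types, lifting) Pi_I image_eqI one_closed)
qed

lemma B_mult:
  assumes "b \<in> B" "c \<in> B"
  shows "(\<lambda>v\<in>verts G. b v \<otimes> c v) \<in> B"
proof -
  obtain x y where x: "x \<in> edges G \<rightarrow> carrier A" "b = bd x" and y: "y \<in> edges G \<rightarrow> carrier A" "c = bd y"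
    using assms unfolding B_eq by blast
  have "(\<Otimes>e\<in>edges G. (x e \<otimes> y e) [^] coef v e) =
      (\<Otimes>e\<in>edges G. x e [^] coef v e) \<otimes> (\<Otimes>e\<in>edges G. y e [^] coef v e)" for v
  proof -
    have "(\<Otimes>e\<in>edges G. (x e \<otimes> y e) [^] coef v e) =
        (\<Otimes>e\<in>edges G. x e [^] coef v e \<otimes> y e [^] coef v e)"
      using x(1) y(1) by (intro finprod_cong') (auto simp: int_pow_distrib Pi_iff)
    also have "\<dots> = (\<Otimes>e\<in>edges G. x e [^] coef v e) \<otimes> (\<Otimes>e\<in>edges G. y e [^] coef v e)"
      using x(1) y(1) by (intro finprod_multf) (auto simp: Pi_iff)
    finally show ?thesis .
  qed
  then have "bd (\<lambda>e. x e \<otimes> y e) = (\<lambda>v\<in>verts G. b v \<otimes> c v)"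
    by (simp add: bd_def x(2) y(2) cong: restrict_cong)
  moreover have "(\<lambda>e. x e \<otimes> y e) \<in> edges G \<rightarrow> carrier A" using x(1) y(1) by auto
  ultimately show ?thesis unfolding B_eq by (metis image_eqI)
qed

lemma B_finprod:
  assumes "finite I" "\<And>i. i \<in> I \<Longrightarrow> F i \<in> B"
  shows "(\<lambda>v\<in>verts G. \<Otimes>i\<in>I. F i v) \<in> B"
  using assms
proof (induction I rule: finite_induct)
  case empty
  show ?case using B_one by (simp only: finprod_empty)
next
  case (insert i I)
  have car: "F j v \<in> carrier A" if "j \<in> insert i I" "v \<in> verts G" for j v
    using B_closed[OF insert.prems[OF that(1)]] that(2) by auto
  have "(\<lambda>v\<in>verts G. F i v \<otimes> (\<lambda>v\<in>verts G. \<Otimes>i\<in>I. F i v) v) \<in> B"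
    using insert by (intro B_mult) auto
  moreover have "(\<lambda>v\<in>verts G. F i v \<otimes> (\<lambda>v\<in>verts G. \<Otimes>i\<in>I. F i v) v) =
      (\<lambda>v\<in>verts G. \<Otimes>i\<in>insert i I. F i v)"
    using insert.hyps car by (intro restrict_ext) (auto simp: Pi_iff)
  ultimately show ?case by (simp only:)
qed

definition single :: "'v \<Rightarrow> 'a \<Rightarrow> 'v \<Rightarrow> 'a" where
  "single u a = (\<lambda>v\<in>verts G. if v = u then a else \<one>)"

text \<open>The boundary of the chain with value \<open>a\<close> on the orientation of \<open>e\<close> that points outwards at its end \<open>i\<close>.\<close>

lemma B_edge:
  assumes e: "e \<in> edges G" and a: "a \<in> carrier A"
  shows "(\<lambda>v\<in>verts G. a [^] (arrow e i * coef v e)) \<in> B"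
proof -
  define x where "x f = (if f = e then a [^] arrow e i else \<one>)" for f
  have "(\<Otimes>f\<in>edges G. x f [^] coef v f) = a [^] (arrow e i * coef v e)" for v
  proof -
    have "(\<Otimes>f\<in>edges G. x f [^] coef v f) = (\<Otimes>f\<in>edges G. if f = e then x f [^] coef v f else \<one>)"
      using a by (intro finprod_cong') (auto simp: x_def)
    also have "\<dots> = x e [^] coef v e"
      using finprod_delta[of "edges G" "\<lambda>f. x f [^] coef v f" e] finite_edges e a by (simp add: x_def)
    finally show ?thesis using a by (simp add: x_def int_pow_pow)
  qed
  then have "bd x = (\<lambda>v\<in>verts G. a [^] (arrow e i * coef v e))" by (simp add: bd_def)
  moreover have "x \<in> edges G \<rightarrow> carrier A" using a by (simp add: x_def)
  ultimately show ?thesis unfolding B_eq by (metis image_eqI)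
qed

lemma B_edge_two_ends:
  assumes e: "e \<in> edges G" "att G e i = Some u" "att G e (\<not> i) = Some w" and a: "a \<in> carrier A"
  shows "(\<lambda>v\<in>verts G. single u a v \<otimes> single w (a [^] (- esign G e)) v) \<in> B"
proof -
  have "single u a v \<otimes> single w (a [^] (- esign G e)) v = a [^] (arrow e i * coef v e)"
    if "v \<in> verts G" for v
  proof -
    have "arrow e i * coef v e = (if v = u then 1 else 0) + (if v = w then - esign G e else 0)"
      unfolding coef_eq[OF e(1), of v i] using e arrow[OF e(1), of i] by (auto simp: algebra_simps)
    then have "a [^] (arrow e i * coef v e) =
        a [^] (if v = u then 1 else 0 :: int) \<otimes> a [^] (if v = w then - esign G e else 0)"
      using a by (simp only: int_pow_mult)
    then show ?thesis using that a by (simp add: single_def)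
  qed
  then show ?thesis using B_edge[OF e(1) a, of i] by (simp cong: restrict_cong)
qed

lemma B_outer_edge:
  assumes e: "e \<in> edges G" "att G e i = Some u" "att G e (\<not> i) = None" and a: "a \<in> carrier A"
  shows "single u a \<in> B"
proof -
  have "single u a = (\<lambda>v\<in>verts G. a [^] (arrow e i * coef v e))"
    unfolding single_def
  proof (rule restrict_ext)
    fix v
    have "arrow e i * coef v e = (if v = u then 1 else 0)"
      unfolding coef_eq[OF e(1), of v i] using e arrow[OF e(1), of i] by auto
    then show "(if v = u then a else \<one>) = a [^] (arrow e i * coef v e)" using a by auto
  qed
  then show ?thesis using B_edge[OF e(1) a, of i] by simp
qed

lemma single_closed: "a \<in> carrier A \<Longrightarrow> v \<in> verts G \<Longrightarrow> single u a v \<in> carrier A"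
  by (simp add: single_def)

text \<open>
  Modulo boundaries a value can be moved along an edge, at the cost of the sign of the edge, and
  hence along a walk. In additive notation, \<open>a \<delta>\<^sub>u - \<sigma>(p) a \<delta>\<^sub>w\<close> is a boundary.
\<close>

lemma B_walk:
  assumes "walk G u p w" "a \<in> carrier A"
  shows "(\<lambda>v\<in>verts G. single u a v \<otimes> single w (a [^] (- walk_sign G p)) v) \<in> B"
  using assms
proof (induction p arbitrary: u a)
  case Nil
  have "(\<lambda>v\<in>verts G. single u a v \<otimes> single w (a [^] (- walk_sign G [])) v) = (\<lambda>v\<in>verts G. \<one>)"
    using Nil by (intro restrict_ext) (auto simp: single_def int_pow_neg)
  then show ?case using B_one by (simp only:)
next
  case (Cons d p)
  obtain e i where d: "d = (e, i)" by (cases d)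
  obtain x where x: "att G e (\<not> i) = Some x" "walk G x p w" "att G e i = Some u" "e \<in> edges G"
    using Cons.prems by (auto simp: d)
  note a = Cons.prems(2)
  define b where "b = a [^] esign G e"
  have b: "b \<in> carrier A" using a by (simp add: b_def)
  have "(\<lambda>v\<in>verts G. (single u a v \<otimes> single x (a [^] (- esign G e)) v) \<otimes>
      (single x b v \<otimes> single w (b [^] (- walk_sign G p)) v)) \<in> B"
    using B_mult[OF B_edge_two_ends[OF x(4,3,1) a] Cons.IH[OF x(2) b]]
    by (simp cong: restrict_cong)
  moreover have "(\<lambda>v\<in>verts G. (single u a v \<otimes> single x (a [^] (- esign G e)) v) \<otimes>
      (single x b v \<otimes> single w (b [^] (- walk_sign G p)) v)) =
      (\<lambda>v\<in>verts G. single u a v \<otimes> single w (a [^] (- walk_sign G (d # p))) v)"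
  proof (rule restrict_ext)
    fix v assume v: "v \<in> verts G"
    have "single x (a [^] (- esign G e)) v \<otimes> single x b v = \<one>"
      using v a by (auto simp: single_def b_def int_pow_neg)
    moreover have "b [^] (- walk_sign G p) = a [^] (- walk_sign G (d # p))"
      using a by (simp add: b_def int_pow_pow d)
    moreover have "(s \<otimes> t) \<otimes> (t' \<otimes> r) = s \<otimes> r" if "t \<otimes> t' = \<one>"
      "s \<in> carrier A" "t \<in> carrier A" "t' \<in> carrier A" "r \<in> carrier A" for s t t' r
      using that by (metis l_one m_assoc m_closed)
    ultimately show "(single u a v \<otimes> single x (a [^] (- esign G e)) v) \<otimes>
      (single x b v \<otimes> single w (b [^] (- walk_sign G p)) v) =
      single u a v \<otimes> single w (a [^] (- walk_sign G (d # p))) v"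
      using v a b single_closed by auto
  qed
  ultimately show ?case by (simp only:)
qed

text \<open>The elements \<open>a\<close> for which \<open>a\<close> concentrated at the root \<open>r\<close> is a boundary.\<close>

definition root_values :: "'v \<Rightarrow> 'a set" where
  "root_values r = (if has_outer_edge (component_at G r) then carrier A
     else if balanced (component_at G r) then {\<one>} else carrier (twice A))"

lemma subgroup_root_values: "subgroup (root_values r) A"
  using triv_subgroup subgroup_self subgroup_twice[OF comm_group_axioms] by (simp add: root_values_def)

text \<open>
  From an outer-edge any value can be moved to the root. Moving \<open>c\<close> around a negative closed walk
  at the root shows that \<open>2c\<close> at the root is a boundary.
\<close>

lemma single_root_in_B:
  assumes r: "r \<in> roots G" and a: "a \<in> root_values r"
  shows "single r a \<in> B"
proof -
  have aA: "a \<in> carrier A" using a subgroup.subset[OF subgroup_root_values] by blast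
  consider "has_outer_edge (component_at G r)" | "\<not> has_outer_edge (component_at G r)" "balanced (component_at G r)"
    | "\<not> has_outer_edge (component_at G r)" "\<not> balanced (component_at G r)" by blast
  then show ?thesis
  proof cases
    case 1
    then obtain e where e: "e \<in> edges (component_at G r)" "is_outer G e"
      by (auto simp: has_outer_edge_def is_outer_def)
    then obtain i u where u: "e \<in> edges G" "att G e i = Some u" "rep G u = r" by auto
    have n: "att G e (\<not> i) = None"
    proof (rule ccontr)
      assume "att G e (\<not> i) \<noteq> None"
      then have "(\<not> i) = i" using e(2) u(2) unfolding is_outer_def by blast
      then show False by blast
    qed
    obtain p where p: "walk G u p r" using adj_rtrancl_walk[OF rep_adj_rtrancl[of u G]] u(3) by blast
    obtain q where q: "walk G r q u" using walk_reverse[OF p] by blast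
    have "(\<lambda>v\<in>verts G. (single r a v \<otimes> single u (a [^] (- walk_sign G q)) v) \<otimes>
        single u (a [^] walk_sign G q) v) \<in> B"
      using B_mult[OF B_walk[OF q aA] B_outer_edge[OF u(1,2) n]] aA
      by (simp cong: restrict_cong)
    moreover have "(\<lambda>v\<in>verts G. (single r a v \<otimes> single u (a [^] (- walk_sign G q)) v) \<otimes>
        single u (a [^] walk_sign G q) v) = single r a"
      using aA by (auto simp: single_def int_pow_neg m_assoc)
    ultimately show ?thesis by simp
  next
    case 2
    then have "single r a = (\<lambda>v\<in>verts G. \<one>)" using a by (auto simp: root_values_def single_def)
    then show ?thesis using B_one by simp
  next
    case 3
    then obtain c where c: "c \<in> carrier A" "a = c [^] (2::int)"
      using a by (auto simp: root_values_def twice_def)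
    obtain p where p: "walk G r p r" "walk_sign G p \<noteq> 1"
      using 3 balanced_comp_iff[OF signed_graph] by blast
    then have "walk_sign G p = -1" using walk_sign_range[OF signed_graph p(1)] by simp
    moreover have "c \<otimes> c = c [^] (2::int)" using c(1) int_pow_mult[of c 1 1] by simp
    ultimately have "(\<lambda>v\<in>verts G. single r c v \<otimes> single r (c [^] (- walk_sign G p)) v) = single r a"
      using c by (auto simp: single_def)
    then show ?thesis using B_walk[OF p(1) c(1)] by simp
  qed
qed


abbreviation root_sum :: "('v \<Rightarrow> int) \<Rightarrow> 'v \<Rightarrow> ('v \<Rightarrow> 'a) \<Rightarrow> 'a" where
  "root_sum \<nu> r b \<equiv> weighted_sum (component_at G r) A \<nu> b"

lemma root_sum_eq: "root_sum \<nu> r b = (\<Otimes>v\<in>{v \<in> verts G. rep G v = r}. b v [^] \<nu> v)"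
  by (simp add: weighted_sum_def)

text \<open>
  The coefficient with which the value on \<open>e\<close> enters the weighted sum of a boundary over the
  component of \<open>r\<close>.
\<close>

lemma coef_root_sum:
  assumes e: "e \<in> edges G" and u: "att G e i = Some u" and w: "att G e (\<not> i) = Some w"
  shows "(\<Sum>v\<in>{v \<in> verts G. rep G v = r}. coef v e * \<nu> v) =
    (if rep G u = r then arrow e i * \<nu> u + arrow e (\<not> i) * \<nu> w else 0)"
proof -
  let ?C = "{v \<in> verts G. rep G v = r}"
  have fin: "finite ?C" using finite_verts by simp
  have uw: "u \<in> verts G" "w \<in> verts G" "rep G w = rep G u"
    using att_verts[OF e] u w rep_edge[OF e w u] by auto
  have "(\<Sum>v\<in>?C. coef v e * \<nu> v) =
      (\<Sum>v\<in>?C. (if v = u then arrow e i * \<nu> v else 0) + (if v = w then arrow e (\<not> i) * \<nu> v else 0))"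
    by (rule sum.cong[OF refl]) (auto simp: coef_eq[OF e, of _ i] u w algebra_simps)
  also have "\<dots> = (if u \<in> ?C then arrow e i * \<nu> u else 0) + (if w \<in> ?C then arrow e (\<not> i) * \<nu> w else 0)"
    using fin by (simp add: sum.distrib)
  finally show ?thesis using uw by auto
qed

lemma coef_root_sum_untouched:
  assumes e: "e \<in> edges G" "e \<notin> edges (component_at G r)"
  shows "(\<Sum>v\<in>{v \<in> verts G. rep G v = r}. coef v e * \<nu> v) = 0"
proof (rule sum.neutral, intro ballI)
  fix v assume "v \<in> {v \<in> verts G. rep G v = r}"
  then have "att G e True \<noteq> Some v" "att G e False \<noteq> Some v" using e by auto
  then show "coef v e * \<nu> v = 0" using coef_eq[OF e(1), of v True] by simp
qed

lemma root_sum_bd: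
  assumes x: "x \<in> edges G \<rightarrow> carrier A"
  shows "root_sum \<nu> r (bd x) =
    (\<Otimes>e\<in>edges G. x e [^] (\<Sum>v\<in>{v \<in> verts G. rep G v = r}. coef v e * \<nu> v))"
proof -
  let ?C = "{v \<in> verts G. rep G v = r}"
  have fin: "finite ?C" using finite_verts by simp
  have "root_sum \<nu> r (bd x) = (\<Otimes>v\<in>?C. \<Otimes>e\<in>edges G. x e [^] (coef v e * \<nu> v))"
    unfolding root_sum_eq
  proof (rule finprod_cong')
    fix v assume v: "v \<in> ?C"
    have "(\<Otimes>e\<in>edges G. x e [^] coef v e) [^] \<nu> v = (\<Otimes>e\<in>edges G. (x e [^] coef v e) [^] \<nu> v)"
      using x by (intro finprod_int_pow) auto
    also have "\<dots> = (\<Otimes>e\<in>edges G. x e [^] (coef v e * \<nu> v))"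
      using x by (intro finprod_cong') (auto simp: int_pow_pow Pi_iff)
    finally show "bd x v [^] \<nu> v = (\<Otimes>e\<in>edges G. x e [^] (coef v e * \<nu> v))"
      using v by (simp add: bd_def)
  qed (use x in \<open>auto simp: Pi_iff\<close>)
  also have "\<dots> = (\<Otimes>e\<in>edges G. \<Otimes>v\<in>?C. x e [^] (coef v e * \<nu> v))"
    using x fin by (intro finprod_swap) auto
  also have "\<dots> = (\<Otimes>e\<in>edges G. x e [^] (\<Sum>v\<in>?C. coef v e * \<nu> v))"
    using x fin by (intro finprod_cong') (auto simp: int_pow_sum Pi_iff)
  finally show ?thesis .
qed

text \<open>
  With both ends attached, an edge contributes to the weighted sum with coefficient
  \<open>\<plusminus>1 \<plusminus> 1\<close>, which is even, and which vanishes if the switched edge is positive.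
\<close>

lemma root_sum_in_root_values:
  assumes \<nu>: "gauge G \<nu>" and b: "b \<in> B" and r: "r \<in> roots G"
  shows "root_sum \<nu> r b \<in> root_values r"
proof -
  obtain x where x: "x \<in> edges G \<rightarrow> carrier A" "b = bd x" using b unfolding B_eq by blast
  have "x e [^] (\<Sum>v\<in>{v \<in> verts G. rep G v = r}. coef v e * \<nu> v) \<in> root_values r"
    if e: "e \<in> edges G" for e
  proof -
    have xe: "x e \<in> carrier A" using x(1) e by auto
    consider "has_outer_edge (component_at G r)" | "e \<notin> edges (component_at G r)"
      | "\<not> has_outer_edge (component_at G r)" "e \<in> edges (component_at G r)" by blast
    then show ?thesis
    proof cases
      case 1
      then show ?thesis using xe by (simp add: root_values_def)
    next
      case 2
      then show ?thesis
        using coef_root_sum_untouched[OF e 2] subgroup.one_closed[OF subgroup_root_values] by simp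
    next
      case 3
      have "\<not> is_outer G e" using 3 by (auto simp: has_outer_edge_def is_outer_def)
      then obtain u w where uw: "att G e True = Some u" "att G e (\<not> True) = Some w"
        using both_ends_attached[OF signed_graph e] by metis
      obtain j t where "att G e j = Some t" "rep G t = r" using 3(2) by auto
      then have "rep G u = r" using rep_edge[OF e uw(1)] by simp
      then have k: "(\<Sum>v\<in>{v \<in> verts G. rep G v = r}. coef v e * \<nu> v) =
          arrow e True * \<nu> u + arrow e False * \<nu> w" (is "?k = _")
        using coef_root_sum[OF e uw, of \<nu> r] by simp
      have a: "arrow e True \<in> {1, -1}" "arrow e True * arrow e False = - esign G e"
        using arrow[OF e, of True] by auto
      have n: "\<nu> u \<in> {1, -1}" "\<nu> w \<in> {1, -1}"
        using \<nu> uw att_verts[OF e] by (auto simp: gauge_def switching_def)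
      show ?thesis
      proof (cases "balanced (component_at G r)")
        case True
        then have "walk_sign G p = 1" if "walk G r p r" for p
          using balanced_comp_iff[OF signed_graph] that r by (auto simp: roots_def)
        then have "positive_on G \<nu> e" using gauge_positive_on[OF signed_graph \<nu>] 3(2) by blast
        then have "esign G e = \<nu> u * \<nu> w" using uw unfolding positive_on_def by blast
        then have "?k = 0" using a n k by auto
        then show ?thesis using subgroup.one_closed[OF subgroup_root_values] by simp
      next
        case False
        have "even ?k" using a n esign_range[OF e] k by auto
        then obtain m where "?k = 2 * m" by blast
        then have m: "?k = m * 2" by linarith
        have "x e [^] ?k = (x e [^] m) [^] (2::int)" by (simp only: int_pow_pow[OF xe] m)
        then show ?thesis using False 3(1) xe by (auto simp: root_values_def twice_def)
      qed
    qed
  qed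
  then show ?thesis
    unfolding x(2) root_sum_bd[OF x(1)] by (rule finprod_in_subgroup[OF subgroup_root_values])
qed

lemma gauge_range: "gauge G \<nu> \<Longrightarrow> v \<in> verts G \<Longrightarrow> \<nu> v \<in> {1, -1}"
  by (simp add: gauge_def switching_def)

lemma root_sum_closed: "b \<in> verts G \<rightarrow>\<^sub>E carrier A \<Longrightarrow> root_sum \<nu> r b \<in> carrier A"
  unfolding root_sum_eq by (intro finprod_closed) auto

lemma roots_subset: "roots G \<subseteq> verts G"
  by (auto simp: roots_def)

text \<open>
  Moving every \<open>b(v)\<close> to the root of its component changes \<open>b\<close> by a boundary and collects the
  signed sum of \<open>b\<close> over the component at that root.
\<close>

lemma B_if_root_sums:
  assumes \<nu>: "gauge G \<nu>" and b: "b \<in> verts G \<rightarrow>\<^sub>E carrier A"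
    and rs: "\<And>r. r \<in> roots G \<Longrightarrow> root_sum \<nu> r b \<in> root_values r"
  shows "b \<in> B"
proof -
  let ?V = "verts G"
  \<comment> \<open>\<open>F v\<close> moves \<open>b v\<close> to the root of \<open>v\<close>; \<open>S r\<close> is what accumulates at the root \<open>r\<close>.\<close>
  define c where "c v = b v [^] (- (\<nu> v * \<nu> (rep G v)))" for v
  have bV: "b v \<in> carrier A" "c v \<in> carrier A" if "v \<in> ?V" for v using b that by (auto simp: c_def)
  define F where "F v = (\<lambda>w\<in>?V. single v (b v) w \<otimes> single (rep G v) (c v) w)" for v
  define S where "S r = root_sum \<nu> r b [^] \<nu> r" for r
  have SA: "S r \<in> carrier A" for r using root_sum_closed[OF b] by (simp add: S_def)
  have F: "F v \<in> B" if v: "v \<in> ?V" for v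
  proof -
    obtain p where "walk G v p (rep G v)" "walk_sign G p = \<nu> v * \<nu> (rep G v)"
      using \<nu> v by (auto simp: gauge_def)
    then show ?thesis using B_walk[of v p "rep G v" "b v"] bV[OF v] unfolding F_def c_def by simp
  qed
  have S: "single r (S r) \<in> B" if r: "r \<in> roots G" for r
  proof (rule single_root_in_B[OF r])
    have range: "\<nu> r \<in> {1, -1}" using gauge_range[OF \<nu>] r roots_subset by blast
    show "S r \<in> root_values r"
      using range rs[OF r] root_sum_closed[OF b, of r \<nu>]
        subgroup.m_inv_closed[OF subgroup_root_values]
      by (auto simp: S_def int_pow_neg)
  qed
  have finR: "finite (roots G)" using finite_verts roots_subset by (rule rev_finite_subset)
  have "(\<lambda>w\<in>?V. (\<lambda>w\<in>?V. \<Otimes>v\<in>?V. F v w) w \<otimes> (\<lambda>w\<in>?V. \<Otimes>r\<in>roots G. single r (S r) w) w) \<in> B"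
    by (intro B_mult B_finprod F S finite_verts finR)
  moreover have "(\<Otimes>v\<in>?V. F v w) \<otimes> (\<Otimes>r\<in>roots G. single r (S r) w) = b w" if w: "w \<in> ?V" for w
  proof -
    have "(\<Otimes>r\<in>roots G. single r (S r) w) = (\<Otimes>r\<in>roots G. if r = w then S r else \<one>)"
      using w SA by (intro finprod_cong') (auto simp: single_def)
    then have S': "(\<Otimes>r\<in>roots G. single r (S r) w) = (if w \<in> roots G then S w else \<one>)"
      using finprod_delta[of "roots G" S w] finR SA by simp
    have "(\<Otimes>v\<in>?V. F v w) = (\<Otimes>v\<in>?V. (if v = w then b v else \<one>) \<otimes> (if rep G v = w then c v else \<one>))"
      using w bV by (intro finprod_cong') (auto simp: F_def single_def)
    also have "\<dots> = (\<Otimes>v\<in>?V. if v = w then b v else \<one>) \<otimes> (\<Otimes>v\<in>?V. if rep G v = w then c v else \<one>)"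
      using bV by (intro finprod_multf) auto
    also have "(\<Otimes>v\<in>?V. if v = w then b v else \<one>) = b w"
      using finprod_delta[of ?V b w] finite_verts bV w by simp
    also have "(\<Otimes>v\<in>?V. if rep G v = w then c v else \<one>) = (\<Otimes>v\<in>{v \<in> ?V. rep G v = w}. c v)"
      by (rule finprod_mono_neutral_cong_right) (use finite_verts bV in auto)
    also have "(\<Otimes>v\<in>{v \<in> ?V. rep G v = w}. c v) =
        (\<Otimes>v\<in>{v \<in> ?V. rep G v = w}. (b v [^] \<nu> v) [^] (- \<nu> w))"
      using bV by (intro finprod_cong') (auto simp: c_def int_pow_pow)
    also have "\<dots> = root_sum \<nu> w b [^] (- \<nu> w)"
      unfolding root_sum_eq using bV by (intro finprod_int_pow[symmetric]) auto
    also have "\<dots> = inv (S w)" using root_sum_closed[OF b] by (simp add: S_def int_pow_neg)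
    finally have F': "(\<Otimes>v\<in>?V. F v w) = b w \<otimes> inv (S w)" .
    show ?thesis
    proof (cases "w \<in> roots G")
      case True
      then show ?thesis using F' S' SA bV[OF w] by (simp add: m_assoc)
    next
      case False
      then have "{v \<in> ?V. rep G v = w} = {}" using rep_in_roots[OF signed_graph] by auto
      then have "S w = \<one>" by (simp only: S_def root_sum_eq finprod_empty int_pow_one)
      then show ?thesis using False F' S' bV[OF w] by simp
    qed
  qed
  then have "(\<lambda>w\<in>?V. (\<lambda>w\<in>?V. \<Otimes>v\<in>?V. F v w) w \<otimes> (\<lambda>w\<in>?V. \<Otimes>r\<in>roots G. single r (S r) w) w) = b"
    using b by (auto simp: PiE_def extensional_def)
  ultimately show ?thesis by (simp only:)
qed

lemma B_iff:
  assumes "gauge G \<nu>"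
  shows "b \<in> B \<longleftrightarrow> b \<in> verts G \<rightarrow>\<^sub>E carrier A \<and> (\<forall>r\<in>roots G. root_sum \<nu> r b \<in> root_values r)"
  using B_closed root_sum_in_root_values[OF assms] B_if_root_sums[OF assms] by blast

section \<open>The isomorphism type of the image\<close>

definition vertex_values :: "'v \<Rightarrow> 'a set" where
  "vertex_values v = (if v \<in> roots G then root_values v else carrier A)"

definition B_coords :: "('v \<Rightarrow> 'a) monoid" where
  "B_coords = product_group (verts G) (\<lambda>v. A\<lparr>carrier := vertex_values v\<rparr>)"

definition sum_at_root :: "('v \<Rightarrow> int) \<Rightarrow> ('v \<Rightarrow> 'a) \<Rightarrow> 'v \<Rightarrow> 'a" where
  "sum_at_root \<nu> b = (\<lambda>v\<in>verts G. if v \<in> roots G then root_sum \<nu> v b else b v)"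

lemma root_sum_split:
  assumes b: "b \<in> verts G \<rightarrow>\<^sub>E carrier A" and r: "r \<in> roots G"
  shows "root_sum \<nu> r b = b r [^] \<nu> r \<otimes> (\<Otimes>v\<in>{v \<in> verts G. rep G v = r} - {r}. b v [^] \<nu> v)"
proof -
  have "{v \<in> verts G. rep G v = r} = insert r ({v \<in> verts G. rep G v = r} - {r})"
    using r by (auto simp: roots_def)
  then have "root_sum \<nu> r b = (\<Otimes>v\<in>insert r ({v \<in> verts G. rep G v = r} - {r}). b v [^] \<nu> v)"
    unfolding root_sum_eq by (simp only:)
  also have "\<dots> = b r [^] \<nu> r \<otimes> (\<Otimes>v\<in>{v \<in> verts G. rep G v = r} - {r}. b v [^] \<nu> v)"
    using b r roots_subset finite_verts by (intro finprod_insert) auto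
  finally show ?thesis .
qed

lemma sign_pow_pow: "x \<in> carrier A \<Longrightarrow> k \<in> {1, -1} \<Longrightarrow> (x [^] k) [^] (k :: int) = x"
  by (auto simp: int_pow_pow)

text \<open>
  As \<open>\<nu>(r) = \<plusminus>1\<close>, replacing \<open>b(r)\<close> by the weighted sum over the component of \<open>r\<close>, at all roots
  simultaneously, is an invertible change of coordinates of \<open>C\<^sub>0\<close>. It turns the condition on the
  weighted sums into conditions on single coordinates.
\<close>

lemma B_iso_B_coords:
  assumes \<nu>: "gauge G \<nu>"
  shows "B0 G A \<cong> B_coords"
proof -
  let ?V = "verts G"
  let ?cls = "\<lambda>r. {v \<in> ?V. rep G v = r}"
  define rest where "rest r b = (\<Otimes>v\<in>?cls r - {r}. b v [^] \<nu> v)" for r and b :: "'v \<Rightarrow> 'a"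
  have rest_closed: "rest r b \<in> carrier A" if "b \<in> ?V \<rightarrow>\<^sub>E carrier A" for r b
    unfolding rest_def using that by (intro finprod_closed) auto
  have rest_cong: "rest r b = rest r b'" if "b' \<in> ?V \<rightarrow>\<^sub>E carrier A"
    and "\<And>v. v \<in> ?V \<Longrightarrow> v \<notin> roots G \<Longrightarrow> b v = b' v" for r b b'
    unfolding rest_def using that by (intro finprod_cong') (auto simp: roots_def)
  have split: "root_sum \<nu> r b = b r [^] \<nu> r \<otimes> rest r b" if "b \<in> ?V \<rightarrow>\<^sub>E carrier A" "r \<in> roots G" for r b
    using root_sum_split[OF that] by (simp add: rest_def)
  let ?\<psi> = "sum_at_root \<nu>"
  \<comment> \<open>The inverse solves \<open>f r = \<nu>(r) b(r) + rest r b\<close> for \<open>b(r)\<close>; \<open>rest\<close> involves no coordinate at a root.\<close>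
  define \<theta> where "\<theta> f = (\<lambda>v\<in>?V. if v \<in> roots G then (f v \<otimes> inv (rest v f)) [^] \<nu> v else f v)" for f
  have val: "vertex_values v \<subseteq> carrier A" for v
    using subgroup.subset[OF subgroup_root_values] by (auto simp: vertex_values_def)
  have carP: "carrier B_coords = (\<Pi>\<^sub>E v\<in>?V. vertex_values v)" by (simp add: B_coords_def)
  have PA: "f \<in> ?V \<rightarrow>\<^sub>E carrier A" if "f \<in> carrier B_coords" for f
    using that val unfolding carP by fastforce
  have \<psi>_A: "?\<psi> b \<in> ?V \<rightarrow>\<^sub>E carrier A" if "b \<in> ?V \<rightarrow>\<^sub>E carrier A" for b
    using that root_sum_closed[OF that] by (auto simp: sum_at_root_def PiE_iff)
  have \<theta>_A: "\<theta> f \<in> ?V \<rightarrow>\<^sub>E carrier A" if "f \<in> ?V \<rightarrow>\<^sub>E carrier A" for f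
    using that rest_closed[OF that] by (auto simp: \<theta>_def PiE_iff)
  have \<psi>_P: "?\<psi> b \<in> carrier B_coords" if "b \<in> B" for b
    using that B_iff[OF \<nu>] unfolding carP by (auto simp: sum_at_root_def vertex_values_def)
  have \<theta>\<psi>: "\<theta> (?\<psi> b) = b" if b: "b \<in> ?V \<rightarrow>\<^sub>E carrier A" for b
  proof (rule PiE_ext[OF \<theta>_A[OF \<psi>_A[OF b]] b])
    fix v assume v: "v \<in> ?V"
    have bv: "b v \<in> carrier A" using b v by auto
    have "rest v (?\<psi> b) = rest v b" by (rule rest_cong[OF b]) (auto simp: sum_at_root_def)
    moreover have "(b v [^] \<nu> v \<otimes> rest v b \<otimes> inv (rest v b)) [^] \<nu> v = b v"
      using bv rest_closed[OF b] gauge_range[OF \<nu> v] by (simp add: m_assoc sign_pow_pow)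
    ultimately show "\<theta> (?\<psi> b) v = b v"
      using v split[OF b] by (simp add: \<theta>_def sum_at_root_def)
  qed
  have \<psi>\<theta>: "?\<psi> (\<theta> f) = f" if f: "f \<in> ?V \<rightarrow>\<^sub>E carrier A" for f
  proof (rule PiE_ext[OF \<psi>_A[OF \<theta>_A[OF f]] f])
    fix v assume v: "v \<in> ?V"
    have fv: "f v \<in> carrier A" using f v by auto
    have "rest v (\<theta> f) = rest v f" by (rule rest_cong[OF f]) (auto simp: \<theta>_def)
    moreover have "((f v \<otimes> inv (rest v f)) [^] \<nu> v) [^] \<nu> v \<otimes> rest v f = f v"
      using fv rest_closed[OF f] gauge_range[OF \<nu> v] by (simp add: m_assoc sign_pow_pow)
    ultimately show "?\<psi> (\<theta> f) v = f v"
      using v split[OF \<theta>_A[OF f]] by (simp add: \<theta>_def sum_at_root_def)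
  qed
  have \<theta>_B: "\<theta> f \<in> B" if f: "f \<in> carrier B_coords" for f
    unfolding B_iff[OF \<nu>]
  proof (intro conjI ballI \<theta>_A PA f)
    fix r assume r: "r \<in> roots G"
    then have rV: "r \<in> ?V" using roots_subset by blast
    have "root_sum \<nu> r (\<theta> f) = ?\<psi> (\<theta> f) r" using r rV by (simp add: sum_at_root_def)
    also have "\<dots> = f r" by (simp only: \<psi>\<theta>[OF PA[OF f]])
    finally have "root_sum \<nu> r (\<theta> f) = f r" .
    moreover have "f r \<in> root_values r"
      using PiE_mem[OF f[unfolded carP] rV] r by (simp add: vertex_values_def)
    ultimately show "root_sum \<nu> r (\<theta> f) \<in> root_values r" by simp
  qed
  have "bij_betw ?\<psi> B (carrier B_coords)"
  proof (rule bij_betw_byWitness[where f' = \<theta>])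
    show "\<forall>b\<in>B. \<theta> (?\<psi> b) = b" using \<theta>\<psi> B_closed by blast
    show "\<forall>f\<in>carrier B_coords. ?\<psi> (\<theta> f) = f" using \<psi>\<theta> PA by blast
    show "?\<psi> ` B \<subseteq> carrier B_coords" using \<psi>_P by (rule image_subsetI)
    show "\<theta> ` carrier B_coords \<subseteq> B" using \<theta>_B by (rule image_subsetI)
  qed
  moreover have "?\<psi> \<in> hom (B0 G A) B_coords"
  proof (rule homI)
    fix b c assume "b \<in> B" "c \<in> B"
    then have bc: "b \<in> ?V \<rightarrow>\<^sub>E carrier A" "c \<in> ?V \<rightarrow>\<^sub>E carrier A" using B_closed by auto
    have "root_sum \<nu> r (\<lambda>v\<in>?V. b v \<otimes> c v) = root_sum \<nu> r b \<otimes> root_sum \<nu> r c" for r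
    proof -
      have "root_sum \<nu> r (\<lambda>v\<in>?V. b v \<otimes> c v) = (\<Otimes>v\<in>?cls r. b v [^] \<nu> v \<otimes> c v [^] \<nu> v)"
        unfolding root_sum_eq using bc by (intro finprod_cong') (auto simp: int_pow_distrib PiE_iff)
      also have "\<dots> = root_sum \<nu> r b \<otimes> root_sum \<nu> r c"
        unfolding root_sum_eq using bc by (intro finprod_multf) auto
      finally show ?thesis .
    qed
    then show "?\<psi> (b \<otimes>\<^bsub>B0 G A\<^esub> c) = ?\<psi> b \<otimes>\<^bsub>B_coords\<^esub> ?\<psi> c"
      by (auto simp: B0_def C0_def B_coords_def sum_at_root_def)
  qed (use \<psi>_P in auto)
  ultimately show ?thesis by (metis isoI is_isoI)
qed

text \<open>
  The vertices fall into three kinds: roots of balanced components, which contribute a trivial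
  factor; roots of unbalanced components without outer-edges, which contribute \<open>2A\<close>; and all others,
  which contribute \<open>A\<close>. It remains to number the vertices of the last two kinds.
\<close>

lemma B_coords_iso:
  shows "B_coords \<cong> gpow (twice A) (num_unbalanced_closed G)
           \<times>\<times> gpow A (rank G - num_unbalanced_closed G)"
proof -
  let ?V = "verts G"
  define R1 where "R1 = {r \<in> roots G. balanced (component_at G r)}"
  define R2 where "R2 = {r \<in> roots G. \<not> balanced (component_at G r) \<and> \<not> has_outer_edge (component_at G r)}"
  define R3 where "R3 = ?V - R1 - R2"
  have sub: "R1 \<subseteq> ?V" "R2 \<subseteq> ?V" "R1 \<inter> R2 = {}"
    using roots_subset by (auto simp: R1_def R2_def)
  have fin: "finite R1" "finite R2" "finite R3"
    using finite_verts sub by (auto simp: R3_def intro: rev_finite_subset)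
  have num: "num_unbalanced_closed G = card R2" "num_balanced G = card R1"
    by (simp_all add: num_unbalanced_closed_def num_balanced_def card_components[OF signed_graph]
        R1_def R2_def)
  have "card R3 = card ?V - card R1 - card R2"
    unfolding R3_def using sub fin finite_verts by (subst card_Diff_subset card_Diff_subset; auto)+
  then have num3: "rank G - num_unbalanced_closed G = card R3" by (simp add: rank_def num)
  have U1: "vertex_values v = {\<one>}" if "v \<in> R1" for v
    using that by (auto simp: R1_def vertex_values_def root_values_def balanced_def)
  have U2: "vertex_values v = carrier (twice A)" if "v \<in> R2" for v
    using that by (auto simp: R2_def vertex_values_def root_values_def)
  have U3: "vertex_values v = carrier A" if "v \<in> R3" for v
    using that by (auto simp: R1_def R2_def R3_def vertex_values_def root_values_def)
  obtain h2 where h2: "bij_betw h2 {..<card R2} R2"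
    using ex_bij_betw_nat_finite[OF fin(2)] by (auto simp: atLeast0LessThan)
  obtain h3 where h3: "bij_betw h3 {..<card R3} R3"
    using ex_bij_betw_nat_finite[OF fin(3)] by (auto simp: atLeast0LessThan)
  define k2 where "k2 = inv_into {..<card R2} h2"
  define k3 where "k3 = inv_into {..<card R3} h3"
  have h2': "h2 i \<in> R2" "k2 (h2 i) = i" if "i < card R2" for i
    using h2 that by (auto simp: k2_def bij_betw_def inv_into_f_f)
  have h3': "h3 i \<in> R3" "k3 (h3 i) = i" if "i < card R3" for i
    using h3 that by (auto simp: k3_def bij_betw_def inv_into_f_f)
  have k2': "k2 v < card R2" "h2 (k2 v) = v" if "v \<in> R2" for v
    using bij_betwE[OF bij_betw_inv_into[OF h2]] bij_betw_inv_into_right[OF h2] that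
    by (auto simp: k2_def)
  have k3': "k3 v < card R3" "h3 (k3 v) = v" if "v \<in> R3" for v
    using bij_betwE[OF bij_betw_inv_into[OF h3]] bij_betw_inv_into_right[OF h3] that
    by (auto simp: k3_def)
  have dis: "v \<notin> R2" "v \<notin> R1" if "v \<in> R3" for v using that by (auto simp: R3_def)
  have V: "v \<in> R1 \<or> v \<in> R2 \<or> v \<in> R3" if "v \<in> ?V" for v using that by (auto simp: R3_def)
  have inV: "v \<in> ?V" if "v \<in> R2 \<or> v \<in> R3" for v using that sub by (auto simp: R3_def)
  define P where "P f = (\<lambda>i\<in>{..<card R2}. f (h2 i), \<lambda>i\<in>{..<card R3}. f (h3 i))" for f :: "'v \<Rightarrow> 'a"
  define Q where "Q pq = (\<lambda>v\<in>?V. if v \<in> R2 then fst pq (k2 v)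
      else if v \<in> R3 then snd pq (k3 v) else \<one>)" for pq :: "(nat \<Rightarrow> 'a) \<times> (nat \<Rightarrow> 'a)"
  let ?T = "gpow (twice A) (card R2) \<times>\<times> gpow A (card R3)"
  have carT: "carrier ?T = ({..<card R2} \<rightarrow>\<^sub>E carrier (twice A)) \<times> ({..<card R3} \<rightarrow>\<^sub>E carrier A)"
    by (simp add: gpow_def)
  have carP: "carrier B_coords = (\<Pi>\<^sub>E v\<in>?V. vertex_values v)" by (simp add: B_coords_def)
  have P_in: "P f \<in> carrier ?T" if f: "f \<in> carrier B_coords" for f
  proof -
    have fv: "f v \<in> vertex_values v" if "v \<in> R2 \<or> v \<in> R3" for v
      using PiE_mem[OF f[unfolded carP] inV[OF that]] .
    have "f (h2 i) \<in> carrier (twice A)" if "i < card R2" for i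
      using fv[of "h2 i"] h2'(1)[OF that] U2 by simp
    moreover have "f (h3 i) \<in> carrier A" if "i < card R3" for i
      using fv[of "h3 i"] h3'(1)[OF that] U3 by simp
    ultimately show ?thesis unfolding carT P_def by (simp add: PiE_iff)
  qed
  have Q_in: "Q pq \<in> carrier B_coords" if "pq \<in> carrier ?T" for pq
  proof -
    have "Q pq v \<in> vertex_values v" if "v \<in> ?V" for v
      using V[OF that] \<open>pq \<in> carrier ?T\<close> k2'(1) k3'(1) dis that U1 U2 U3 sub(3) unfolding carT Q_def
      by (auto 4 3 simp: PiE_iff)
    then show ?thesis unfolding carP by (auto simp: Q_def)
  qed
  have QP: "Q (P f) = f" if f: "f \<in> carrier B_coords" for f
  proof (rule PiE_ext)
    show "Q (P f) \<in> (\<Pi>\<^sub>E v\<in>?V. vertex_values v)" "f \<in> (\<Pi>\<^sub>E v\<in>?V. vertex_values v)"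
      using Q_in[OF P_in[OF f]] f by (simp_all add: carP)
    fix v assume v: "v \<in> ?V"
    have "f v \<in> vertex_values v" using f v unfolding carP by auto
    then have "f v = \<one>" if "v \<in> R1" using U1[OF that] by simp
    then show "Q (P f) v = f v"
      using V[OF v] v k2' k3' by (auto simp: Q_def P_def)
  qed
  have PQ: "P (Q pq) = pq" if pq: "pq \<in> carrier ?T" for pq
  proof -
    have "fst (P (Q pq)) = fst pq"
      using pq h2' inV unfolding carT by (intro extensionalityI[of _ "{..<card R2}"])
        (auto simp: P_def Q_def PiE_iff mem_Times_iff)
    moreover have "snd (P (Q pq)) = snd pq"
      using pq h3' inV dis unfolding carT by (intro extensionalityI[of _ "{..<card R3}"])
        (auto simp: P_def Q_def PiE_iff mem_Times_iff)
    ultimately show ?thesis by (rule prod_eqI)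
  qed
  have "bij_betw P (carrier B_coords) (carrier ?T)"
  proof (rule bij_betw_byWitness[where f' = Q])
    show "\<forall>f\<in>carrier B_coords. Q (P f) = f" using QP by blast
    show "\<forall>pq\<in>carrier ?T. P (Q pq) = pq" using PQ by blast
    show "P ` carrier B_coords \<subseteq> carrier ?T" using P_in by (rule image_subsetI)
    show "Q ` carrier ?T \<subseteq> carrier B_coords" using Q_in by (rule image_subsetI)
  qed
  moreover have "P \<in> hom B_coords ?T"
  proof (rule homI)
    fix f g
    have "h2 i \<in> ?V" if "i < card R2" for i using inV h2'(1)[OF that] by blast
    moreover have "h3 i \<in> ?V" if "i < card R3" for i using inV h3'(1)[OF that] by blast
    ultimately show "P (f \<otimes>\<^bsub>B_coords\<^esub> g) = P f \<otimes>\<^bsub>?T\<^esub> P g"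
      by (auto simp: P_def B_coords_def gpow_def DirProd_def twice_def)
  qed (rule P_in)
  ultimately have "B_coords \<cong> ?T" by (metis isoI is_isoI)
  then show ?thesis by (simp only: num(1) num3[unfolded num(1)])
qed

end

lemma gpow_0_DirProd: "gpow A 0 \<times>\<times> C \<cong> C"
proof -
  have "snd \<in> iso (gpow A 0 \<times>\<times> C) C"
    by (rule isoI) (auto simp: hom_def gpow_def bij_betw_def inj_on_def image_iff)
  then show ?thesis by (rule is_isoI)
qed

lemma gpow_1_DirProd: "gpow A 1 \<times>\<times> C \<cong> A \<times>\<times> C"
proof -
  let ?g = "\<lambda>(x, c). (\<lambda>i\<in>{..<1::nat}. x, c)"
  have "bij_betw (\<lambda>(f, c). (f 0, c)) (carrier (gpow A 1 \<times>\<times> C)) (carrier (A \<times>\<times> C))"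
    by (rule bij_betw_byWitness[where f' = ?g])
      (auto simp: gpow_def PiE_iff extensional_def fun_eq_iff split: if_splits)
  then have "(\<lambda>(f, c). (f 0, c)) \<in> iso (gpow A 1 \<times>\<times> C) (A \<times>\<times> C)"
    by (intro isoI) (auto simp: hom_def gpow_def)
  then show ?thesis by (rule is_isoI)
qed

theorem theorem5p2:
  fixes G :: "('v, 'e) sgraph" and A :: "'a monoid"
  assumes "signed_graph G" and "comm_group A"
  shows
    "B0 G A \<cong> gpow (twice A) (num_unbalanced_closed G)
              \<times>\<times> gpow A (rank G - num_unbalanced_closed G)
     \<and>
     (graph_connected G \<longrightarrow>
        (\<forall>\<nu>. balanced G \<and> switching G \<nu> \<and> (\<forall>e\<in>edges G. esign (switch G \<nu>) e = 1) \<longrightarrow>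
             carrier (B0 G A) = {b \<in> carrier (C0 G A). weighted_sum G A \<nu> b = \<one>\<^bsub>A\<^esub>} \<and>
             B0 G A \<cong> gpow A (card (verts G) - 1))
        \<and>
        (\<forall>\<nu>. \<not> balanced G \<and> \<not> has_outer_edge G \<and> switching G \<nu> \<and>
             (\<exists>T. spanning_tree T G \<and> (\<forall>e\<in>edges T. esign (switch G \<nu>) e = 1)) \<longrightarrow>
             carrier (B0 G A) =
               {b \<in> carrier (C0 G A). weighted_sum G A \<nu> b \<in> carrier (twice A)} \<and>
             B0 G A \<cong> twice A \<times>\<times> gpow A (card (verts G) - 1))
        \<and>
        (has_outer_edge G \<longrightarrow>
             B0 G A = C0 G A \<and> C0 G A \<cong> gpow A (card (verts G))))"
    (is "?general \<and> (graph_connected G \<longrightarrow> ?a \<and> ?b \<and> ?c)")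
proof -
  interpret signed_graph_coeff A G
    using assms by (simp add: signed_graph_coeff_def signed_graph_coeff_axioms_def)
  have general: ?general
    using gauge_exists[OF signed_graph] B_iso_B_coords B_coords_iso iso_trans by blast
  have "?a \<and> ?b \<and> ?c" if con: "graph_connected G"
  proof -
    obtain v where "v \<in> verts G" using con by (auto simp: graph_connected_def)
    then have root: "rep G v \<in> roots G" by (rule rep_in_roots[OF signed_graph])
    note whole = connected_component[OF signed_graph con root]
    have C0: "carrier (C0 G A) = verts G \<rightarrow>\<^sub>E carrier A" by (simp add: C0_def)
    have B: "B = {b \<in> carrier (C0 G A). weighted_sum G A \<nu> b \<in> root_values (rep G v)}"
      if "gauge G \<nu>" for \<nu>
      using B_iff[OF that] whole by (auto simp: C0)
    have "{r \<in> roots G. P (component_at G r)} = (if P G then {rep G v} else {})" for P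
      using whole by auto
    then have card: "card {H \<in> components G. P H} = (if P G then 1 else 0)" for P
      by (simp add: card_components[OF signed_graph])
    have num: "num_unbalanced_closed G = (if balanced G \<or> has_outer_edge G then 0 else 1)"
      "num_balanced G = (if balanced G then 1 else 0)"
      by (simp_all add: num_unbalanced_closed_def num_balanced_def card)
    have ?a
    proof (intro allI impI)
      fix \<nu> assume h: "balanced G \<and> switching G \<nu> \<and> (\<forall>e\<in>edges G. esign (switch G \<nu>) e = 1)"
      then have "gauge G \<nu>"
        using con signed_graph
        by (intro gauge_if_positive_on_connected_spanning[of G \<nu> G] positive_onI)
          (auto simp: subgraph_def)
      moreover have "root_values (rep G v) = {\<one>\<^bsub>A\<^esub>}"
        using h by (simp add: root_values_def whole balanced_def)
      moreover have "B0 G A \<cong> gpow (twice A) 0 \<times>\<times> gpow A (card (verts G) - 1)"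
        using general h by (simp add: num rank_def)
      from iso_trans[OF this gpow_0_DirProd] have "B0 G A \<cong> gpow A (card (verts G) - 1)" .
      ultimately show "B = {b \<in> carrier (C0 G A). weighted_sum G A \<nu> b = \<one>\<^bsub>A\<^esub>} \<and>
          B0 G A \<cong> gpow A (card (verts G) - 1)" using B by simp
    qed
    moreover have ?b
    proof (intro allI impI)
      fix \<nu> assume h: "\<not> balanced G \<and> \<not> has_outer_edge G \<and> switching G \<nu> \<and>
             (\<exists>T. spanning_tree T G \<and> (\<forall>e\<in>edges T. esign (switch G \<nu>) e = 1))"
      then obtain T where T: "spanning_tree T G" "\<And>e. e \<in> edges T \<Longrightarrow> esign (switch G \<nu>) e = 1" by blast
      then have "gauge G \<nu>"
        using h signed_graph
        by (intro gauge_if_positive_on_connected_spanning[of G \<nu> T] positive_onI)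
          (auto simp: spanning_tree_def subgraph_def)
      moreover have "root_values (rep G v) = carrier (twice A)"
        using h by (simp add: root_values_def whole)
      moreover have "B0 G A \<cong> gpow (twice A) 1 \<times>\<times> gpow A (card (verts G) - 1)"
        using general h by (simp add: num rank_def)
      from iso_trans[OF this gpow_1_DirProd]
      have "B0 G A \<cong> twice A \<times>\<times> gpow A (card (verts G) - 1)" .
      ultimately show "B = {b \<in> carrier (C0 G A). weighted_sum G A \<nu> b \<in> carrier (twice A)} \<and>
          B0 G A \<cong> twice A \<times>\<times> gpow A (card (verts G) - 1)" using B by simp
    qed
    moreover have ?c
    proof
      assume h: "has_outer_edge G"
      obtain \<nu> where \<nu>: "gauge G \<nu>" using gauge_exists[OF signed_graph] by blast
      have "weighted_sum G A \<nu> b \<in> carrier A" if "b \<in> verts G \<rightarrow>\<^sub>E carrier A" for b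
        using root_sum_closed[OF that, of "rep G v" \<nu>] whole(1) by simp
      then have "B = carrier (C0 G A)"
        using B[OF \<nu>] h by (auto simp: root_values_def whole C0)
      then have eq: "B0 G A = C0 G A" by (simp add: B0_def)
      have "\<not> balanced G" using h by (simp add: balanced_def)
      then have "B0 G A \<cong> gpow (twice A) 0 \<times>\<times> gpow A (card (verts G))"
        using general h by (simp add: num rank_def)
      from iso_trans[OF this gpow_0_DirProd] have "B0 G A \<cong> gpow A (card (verts G))" .
      then show "B0 G A = C0 G A \<and> C0 G A \<cong> gpow A (card (verts G))" using eq by simp
    qed
    ultimately show ?thesis by blast
  qed
  then show ?thesis using general by blast
qed

end
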